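(* The even Weyl group of the hyperbolic Kac--Moody algebra $B_4^{++}$ satisfies $$W^+(B_4^{++})\cong PSL_2^{(0)}(\mathtt{H})\rtimes 2,$$ where $\mathtt{H}$ is the ring of Hurwitz quaternions and $$PSL_2^{(0)}(\mathtt{H})=\Big\{S=\begin{pmatrix}a&b\\c&d\end{pmatrix}\in PSL_2(\mathtt{H})\ \Big|\ ad-bc\equiv1\ (\mathrm{mod}\ \mathtt{C})\Big\},$$ with $\mathtt{C}$ the two-sided ideal of $\mathtt{H}$ generated by all commutators.
   Context: For a Kac--Moody algebra with Cartan matrix $[A_{IJ}]$, the Weyl group $W$ is the Coxeter group with generators $w_I$ and relations $w_I^2=1$, $(w_Iw_J)^{m_{IJ}}=1$ for $I\ne J$, where $m_{IJ}=2,3,4,6,\infty$ according as $A_{IJ}A_{JI}=0,1,2,3,\ge4$. $W^+\subset W$ is the index 2 subgroup of products of an even number of generators. $B_4^{++}$ is the over-extension of $B_4$ (the untwisted affine extension with one more node attached by a single line to the affine node). Its nodes are $-1,0,1,2,3,4$, with $m_{IJ}=3$ for $\{-1,0\},\{0,1\},\{1,2\},\{1,3\}$, $m_{3,4}=4$, and $m_{IJ}=2$ for the other pairs. $\mathtt{H}=\{n_0+n_1i+n_2j+n_3k: \text{all }n_r\in\mathbb{Z}\text{ or all }n_r\in\mathbb{Z}+\tfrac12\}$ is the ring of Hurwitz integers. $\mathtt{C}$ is the two-sided ideal of $\mathtt{H}$ generated by all $ab-ba$, $a,b\in\mathtt{H}$; the quotient $\mathtt{H}/\mathtt{C}$ is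 the field $\mathbb{F}_4$. $SL_2(\mathbb{H})$ is the group of $2\times2$ quaternionic matrices $S$ with $\det(SS^\dagger)=1$, where $S^\dagger$ is the conjugate transpose and the determinant of a Hermitian quaternionic matrix $\begin{pmatrix}p&q\\\bar q&r\end{pmatrix}$ ($p,r\in\mathbb{R}$) is $pr-q\bar q$. $PSL_2(\mathbb{H})=SL_2(\mathbb{H})/\{\pm1\}$, and $PSL_2(\mathtt{H})\subset PSL_2(\mathbb{H})$ is the subgroup of (classes of) matrices with all entries in $\mathtt{H}$. The notation $A\rtimes 2$ means a semi-direct product of $A$ with $\mathbb{Z}/2\mathbb{Z}$: a group with a normal subgroup isomorphic to $A$ of index 2 and a complementary subgroup of order 2, acting on $A$ by conjugation as automorphisms. *)

theory Defs
  imports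
    "HOL-Algebra.Coset"
    "HOL-Algebra.Ideal"
    "HOL-Analysis.Finite_Cartesian_Product"
    "HOL-Library.Extended_Nat"
begin

section \<open>Coxeter groups and Weyl groups\<close>

text \<open>
  The group presented by generators \<open>w\<^sub>i\<close> (\<open>i \<in> I\<close>) and relations \<open>w\<^sub>i\<^sup>2 = 1\<close>,
  \<open>(w\<^sub>i w\<^sub>j)\<^bsup>m i j\<^esup> = 1\<close> for \<open>i \<noteq> j\<close>. Since the relations make every generator its own inverse,
  the elements are classes of words in the generators; no formal inverses are needed.
  For \<open>m i j = \<infinity>\<close> there is no relation.
\<close>

inductive coxeter_equiv :: "'i set \<Rightarrow> ('i \<Rightarrow> 'i \<Rightarrow> enat) \<Rightarrow> 'i list \<Rightarrow> 'i list \<Rightarrow> bool"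
  for I :: "'i set" and m :: "'i \<Rightarrow> 'i \<Rightarrow> enat" where
  refl: "w \<in> lists I \<Longrightarrow> coxeter_equiv I m w w"
| sym: "coxeter_equiv I m u v \<Longrightarrow> coxeter_equiv I m v u"
| trans: "coxeter_equiv I m u v \<Longrightarrow> coxeter_equiv I m v w \<Longrightarrow> coxeter_equiv I m u w"
| square: "\<lbrakk>u \<in> lists I; v \<in> lists I; i \<in> I\<rbrakk> \<Longrightarrow> coxeter_equiv I m (u @ [i, i] @ v) (u @ v)"
| braid: "\<lbrakk>u \<in> lists I; v \<in> lists I; i \<in> I; j \<in> I; i \<noteq> j; m i j = enat k\<rbrakk>
    \<Longrightarrow> coxeter_equiv I m (u @ concat (replicate k [i, j]) @ v) (u @ v)"

definition coxeter_rel :: "'i set \<Rightarrow> ('i \<Rightarrow> 'i \<Rightarrow> enat) \<Rightarrow> ('i list \<times> 'i list) set" where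
  "coxeter_rel I m = {(u, v). coxeter_equiv I m u v}"

definition coxeter_group :: "'i set \<Rightarrow> ('i \<Rightarrow> 'i \<Rightarrow> enat) \<Rightarrow> 'i list set monoid" where
  "coxeter_group I m =
    \<lparr>carrier = lists I // coxeter_rel I m,
     mult = (\<lambda>X Y. \<Union>x\<in>X. \<Union>y\<in>Y. coxeter_rel I m `` {x @ y}),
     one = coxeter_rel I m `` {[]}\<rparr>"

definition coxeter_exponent :: "('i \<Rightarrow> 'i \<Rightarrow> int) \<Rightarrow> 'i \<Rightarrow> 'i \<Rightarrow> enat" where
  "coxeter_exponent A i j =
    (let p = A i j * A j i in
     if p = 0 then 2 else if p = 1 then 3 else if p = 2 then 4 else if p = 3 then 6 else \<infinity>)"

definition weyl_group :: "'i set \<Rightarrow> ('i \<Rightarrow> 'i \<Rightarrow> int) \<Rightarrow> 'i list set monoid" where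
  "weyl_group I A = coxeter_group I (coxeter_exponent A)"

definition even_weyl_group :: "'i set \<Rightarrow> ('i \<Rightarrow> 'i \<Rightarrow> int) \<Rightarrow> 'i list set monoid" where
  "even_weyl_group I A = (weyl_group I A)
    \<lparr>carrier := {coxeter_rel I (coxeter_exponent A) `` {w} | w. w \<in> lists I \<and> even (length w)}\<rparr>"

lemma coxeter_equiv_lists: "coxeter_equiv I m u v \<Longrightarrow> u \<in> lists I \<and> v \<in> lists I"
  by (induction rule: coxeter_equiv.induct) (auto split: if_splits)

lemma equiv_coxeter_rel: "equiv (lists I) (coxeter_rel I m)"
  unfolding coxeter_rel_def
  by (auto intro!: equivI refl_onI symI transI intro: coxeter_equiv.intros
      dest: coxeter_equiv_lists)

lemma coxeter_equiv_append_left: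
  assumes "coxeter_equiv I m u v" "w \<in> lists I"
  shows "coxeter_equiv I m (w @ u) (w @ v)"
  using assms
proof (induction rule: coxeter_equiv.induct)
  case (square u v i)
  then show ?case using coxeter_equiv.square[of "w @ u" I v i m] by simp
next
  case (braid u v i j k)
  then show ?case using coxeter_equiv.braid[of "w @ u" I v i j m k] by simp
next
  case (refl v)
  then show ?case by (intro coxeter_equiv.refl) simp
qed (blast intro: coxeter_equiv.sym coxeter_equiv.trans)+

lemma coxeter_equiv_append_right:
  assumes "coxeter_equiv I m u v" "w \<in> lists I"
  shows "coxeter_equiv I m (u @ w) (v @ w)"
  using assms
proof (induction rule: coxeter_equiv.induct)
  case (square u v i)
  then show ?case using coxeter_equiv.square[of u I "v @ w" i m] by simp
next
  case (braid u v i j k)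
  then show ?case using coxeter_equiv.braid[of u I "v @ w" i j m k] by simp
next
  case (refl v)
  then show ?case by (intro coxeter_equiv.refl) simp
qed (blast intro: coxeter_equiv.sym coxeter_equiv.trans)+

lemma coxeter_equiv_append:
  assumes "coxeter_equiv I m u u'" "coxeter_equiv I m v v'"
  shows "coxeter_equiv I m (u @ v) (u' @ v')"
  by (meson assms coxeter_equiv.trans coxeter_equiv_append_left coxeter_equiv_append_right
      coxeter_equiv_lists)

lemma coxeter_mult_class:
  assumes "u \<in> lists I" "v \<in> lists I"
  shows "coxeter_rel I m `` {u} \<otimes>\<^bsub>coxeter_group I m\<^esub> coxeter_rel I m `` {v}
    = coxeter_rel I m `` {u @ v}"
proof -
  have "congruent2 (coxeter_rel I m) (coxeter_rel I m) (\<lambda>x y. coxeter_rel I m `` {x @ y})"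
    by (intro congruent2I' equiv_class_eq[OF equiv_coxeter_rel])
      (auto simp: coxeter_rel_def intro: coxeter_equiv_append)
  then show ?thesis
    using UN_equiv_class2[OF equiv_coxeter_rel equiv_coxeter_rel] assms
    by (simp add: coxeter_group_def)
qed

lemma coxeter_equiv_rev_append:
  assumes "w \<in> lists I"
  shows "coxeter_equiv I m (rev w @ w) []"
  using assms
proof (induction w)
  case Nil
  then show ?case by (auto intro: coxeter_equiv.refl)
next
  case (Cons i w)
  then have "coxeter_equiv I m (rev w @ [i, i] @ w) (rev w @ w)"
    by (intro coxeter_equiv.square) auto
  with Cons show ?case by (auto intro: coxeter_equiv.trans)
qed

lemma coxeter_group_group: "group (coxeter_group I m)"
proof (rule groupI)
  note mc = coxeter_mult_class[of _ I _ m]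
  let ?G = "coxeter_group I m"
  have carr: "carrier ?G = {coxeter_rel I m `` {w} | w. w \<in> lists I}"
    by (auto simp: coxeter_group_def quotient_def)
  have one: "\<one>\<^bsub>?G\<^esub> = coxeter_rel I m `` {[]}"
    by (simp add: coxeter_group_def)
  show "\<one>\<^bsub>?G\<^esub> \<in> carrier ?G"
    unfolding carr one by blast
  show "x \<otimes>\<^bsub>?G\<^esub> y \<in> carrier ?G" if "x \<in> carrier ?G" "y \<in> carrier ?G" for x y
    using that mc unfolding carr by (smt (verit) append_in_lists_conv mem_Collect_eq)
  show "x \<otimes>\<^bsub>?G\<^esub> y \<otimes>\<^bsub>?G\<^esub> z = x \<otimes>\<^bsub>?G\<^esub> (y \<otimes>\<^bsub>?G\<^esub> z)"
    if "x \<in> carrier ?G" "y \<in> carrier ?G" "z \<in> carrier ?G" for x y z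
  proof -
    from that obtain u v w where "u \<in> lists I" "v \<in> lists I" "w \<in> lists I"
      "x = coxeter_rel I m `` {u}" "y = coxeter_rel I m `` {v}" "z = coxeter_rel I m `` {w}"
      unfolding carr by blast
    then show ?thesis by (simp add: mc)
  qed
  show "\<one>\<^bsub>?G\<^esub> \<otimes>\<^bsub>?G\<^esub> x = x" if "x \<in> carrier ?G" for x
  proof -
    from that obtain u where "u \<in> lists I" "x = coxeter_rel I m `` {u}"
      unfolding carr by blast
    then show ?thesis by (simp add: mc one)
  qed
  show "\<exists>y\<in>carrier ?G. y \<otimes>\<^bsub>?G\<^esub> x = \<one>\<^bsub>?G\<^esub>" if "x \<in> carrier ?G" for x
  proof -
    from that obtain u where u: "u \<in> lists I" "x = coxeter_rel I m `` {u}"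
      unfolding carr by blast
    have r: "rev u \<in> lists I" using u(1) by auto
    have "coxeter_rel I m `` {rev u} \<otimes>\<^bsub>?G\<^esub> x = \<one>\<^bsub>?G\<^esub>"
      unfolding u(2) mc[OF r u(1)] one
      by (intro equiv_class_eq[OF equiv_coxeter_rel])
        (simp add: coxeter_rel_def coxeter_equiv_rev_append u(1))
    then show ?thesis using r unfolding carr by blast
  qed
qed

text \<open>The universal property of the presentation.\<close>

lemma coxeter_group_universal:
  fixes G (structure)
  assumes "group G"
    and f: "\<And>i. i \<in> I \<Longrightarrow> f i \<in> carrier G"
    and sq: "\<And>i. i \<in> I \<Longrightarrow> f i \<otimes> f i = \<one>"
    and br: "\<And>i j k. \<lbrakk>i \<in> I; j \<in> I; i \<noteq> j; m i j = enat k\<rbrakk> \<Longrightarrow> (f i \<otimes> f j) [^] k = \<one>"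
  shows "\<exists>h \<in> hom (coxeter_group I m) G. \<forall>i\<in>I. h (coxeter_rel I m `` {[i]}) = f i"
proof -
  interpret group G by fact
  define e where "e = (\<lambda>w. foldr (\<lambda>i x. f i \<otimes> x) w \<one>)"
  have e_Nil [simp]: "e [] = \<one>" and e_Cons [simp]: "\<And>i w. e (i # w) = f i \<otimes> e w"
    by (simp_all add: e_def)
  have e_closed [simp]: "e w \<in> carrier G" if "w \<in> lists I" for w
    using that by (induction w) (auto simp: f)
  have e_append: "e (u @ v) = e u \<otimes> e v" if "u \<in> lists I" "v \<in> lists I" for u v
    using that by (induction u) (auto simp: f m_assoc)
  have in_lists: "concat (replicate k [i, j]) \<in> lists I" if "i \<in> I" "j \<in> I" for i j k
    using that by (induction k) auto
  have e_rep: "e (concat (replicate k [i, j])) = (f i \<otimes> f j) [^] k" if "i \<in> I" "j \<in> I" for i j k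
    using that
  proof (induction k)
    case (Suc k)
    then show ?case using nat_pow_Suc2[of "f i \<otimes> f j" k] by (simp add: f m_assoc)
  qed simp
  have e_cong: "e u = e v" if "coxeter_equiv I m u v" for u v
    using that
  proof (induction rule: coxeter_equiv.induct)
    case (square u v i)
    then show ?case by (simp add: e_append f sq flip: m_assoc)
  next
    case (braid u v i j k)
    then have l: "concat (replicate k [i, j]) \<in> lists I" by (intro in_lists) auto
    then have "concat (replicate k [i, j]) @ v \<in> lists I" using braid by simp
    moreover have "(f i \<otimes> f j) [^] k = \<one>" using braid by (intro br)
    ultimately show ?case using braid l by (simp add: e_append e_rep)
  qed auto
  define h where "h = (\<lambda>X. \<Union>w\<in>X. {e w})"
  have h: "h (coxeter_rel I m `` {w}) = {e w}" if "w \<in> lists I" for w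
    unfolding h_def
    by (rule UN_equiv_class[OF equiv_coxeter_rel _ that])
      (auto simp: congruent_def coxeter_rel_def e_cong)
  show ?thesis
  proof (intro bexI ballI)
    show "(\<lambda>X. the_elem (h X)) (coxeter_rel I m `` {[i]}) = f i" if "i \<in> I" for i
      using that by (simp add: h f)
    show "(\<lambda>X. the_elem (h X)) \<in> hom (coxeter_group I m) G"
    proof (rule homI)
      fix x y assume "x \<in> carrier (coxeter_group I m)" "y \<in> carrier (coxeter_group I m)"
      then obtain u v where uv: "u \<in> lists I" "x = coxeter_rel I m `` {u}"
          "v \<in> lists I" "y = coxeter_rel I m `` {v}"
        by (auto simp: coxeter_group_def elim!: quotientE)
      show "the_elem (h x) \<in> carrier G" using uv by (simp add: h)
      show "the_elem (h (x \<otimes>\<^bsub>coxeter_group I m\<^esub> y)) = the_elem (h x) \<otimes> the_elem (h y)"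
        using uv coxeter_mult_class[of u I v m] h[of "u @ v"] by (simp add: h e_append)
    qed
  qed
qed


section \<open>The Cartan matrix of B4++\<close>

definition B4pp_nodes :: "int set" where
  "B4pp_nodes = {-1..4}"

text \<open>
  Node 4 is the short root; the orientation of the double bond, i.e. the choice between
  the matrix and its transpose, does not affect the Weyl group.
\<close>

definition B4pp_cartan :: "int \<Rightarrow> int \<Rightarrow> int" where
  "B4pp_cartan i j =
    (if i = j then 2
     else if {i, j} \<in> {{-1, 0}, {0, 1}, {1, 2}, {1, 3}} then -1
     else if (i, j) = (3, 4) then -1
     else if (i, j) = (4, 3) then -2
     else 0)"

lemma B4pp_coxeter_exponent:
  assumes "i \<noteq> j"
  shows "coxeter_exponent B4pp_cartan i j =
    (if {i, j} \<in> {{-1, 0}, {0, 1}, {1, 2}, {1, 3}} then 3 else if {i, j} = {3, 4} then 4 else 2)"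
proof -
  consider "{i, j} \<in> {{-1, 0}, {0, 1}, {1, 2}, {1, 3}}" | "i = 3" "j = 4" | "i = 4" "j = 3"
    | "{i, j} \<notin> {{-1, 0}, {0, 1}, {1, 2}, {1, 3}}" "{i, j} \<noteq> {3, 4}"
    using doubleton_eq_iff[of i j 3 4] by argo
  then show ?thesis
  proof cases
    case 1
    then have "B4pp_cartan i j = -1" "B4pp_cartan j i = -1"
      using assms unfolding B4pp_cartan_def insert_commute[of j i] by presburger+
    with 1 show ?thesis unfolding coxeter_exponent_def by (simp only: if_True) simp
  next
    case 4
    from 4(2) have "(i, j) \<noteq> (3, 4)" "(i, j) \<noteq> (4, 3)"
      unfolding doubleton_eq_iff prod.inject by argo+
    with 4(1) have "B4pp_cartan i j = 0"
      using assms unfolding B4pp_cartan_def by presburger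
    with 4 show ?thesis unfolding coxeter_exponent_def by (simp only: if_False) simp
  qed (simp_all add: coxeter_exponent_def B4pp_cartan_def doubleton_eq_iff)
qed


section \<open>Quaternions\<close>

datatype quat = Quat (quat_re: real) (quat_i: real) (quat_j: real) (quat_k: real)

instantiation quat :: ring_1
begin

definition zero_quat :: quat where "0 = Quat 0 0 0 0"
definition one_quat :: quat where "1 = Quat 1 0 0 0"
definition plus_quat :: "quat \<Rightarrow> quat \<Rightarrow> quat" where
  "x + y = Quat (quat_re x + quat_re y) (quat_i x + quat_i y) (quat_j x + quat_j y) (quat_k x + quat_k y)"
definition minus_quat :: "quat \<Rightarrow> quat \<Rightarrow> quat" where
  "x - y = Quat (quat_re x - quat_re y) (quat_i x - quat_i y) (quat_j x - quat_j y) (quat_k x - quat_k y)"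
definition uminus_quat :: "quat \<Rightarrow> quat" where
  "- x = Quat (- quat_re x) (- quat_i x) (- quat_j x) (- quat_k x)"
definition times_quat :: "quat \<Rightarrow> quat \<Rightarrow> quat" where
  "x * y = Quat
    (quat_re x * quat_re y - quat_i x * quat_i y - quat_j x * quat_j y - quat_k x * quat_k y)
    (quat_re x * quat_i y + quat_i x * quat_re y + quat_j x * quat_k y - quat_k x * quat_j y)
    (quat_re x * quat_j y - quat_i x * quat_k y + quat_j x * quat_re y + quat_k x * quat_i y)
    (quat_re x * quat_k y + quat_i x * quat_j y - quat_j x * quat_i y + quat_k x * quat_re y)"

lemmas quat_defs = zero_quat_def one_quat_def plus_quat_def minus_quat_def uminus_quat_def
  times_quat_def

instance
  by standard (simp_all add: quat_defs algebra_simps)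

end

definition quat_cnj :: "quat \<Rightarrow> quat" where
  "quat_cnj x = Quat (quat_re x) (- quat_i x) (- quat_j x) (- quat_k x)"


section \<open>Hurwitz integers and the commutator ideal\<close>

definition hurwitz :: "quat set" where
  "hurwitz = {Quat a b c d | a b c d.
    (\<forall>x \<in> {a, b, c, d}. x \<in> \<int>) \<or> (\<forall>x \<in> {a, b, c, d}. x - 1/2 \<in> \<int>)}"

definition hurwitz_ring :: "quat ring" where
  "hurwitz_ring = \<lparr>carrier = hurwitz, mult = (*), one = 1, zero = 0, add = (+)\<rparr>"

lemma hurwitz_iff:
  "x \<in> hurwitz \<longleftrightarrow> (\<exists>(p::int) (q::int) (r::int) (s::int). x = Quat (p/2) (p/2 + q) (p/2 + r) (p/2 + s))"
proof
  assume "x \<in> hurwitz"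
  then obtain a b c d where x: "x = Quat a b c d"
    and *: "(a \<in> \<int> \<and> b \<in> \<int> \<and> c \<in> \<int> \<and> d \<in> \<int>) \<or>
      (a - 1/2 \<in> \<int> \<and> b - 1/2 \<in> \<int> \<and> c - 1/2 \<in> \<int> \<and> d - 1/2 \<in> \<int>)"
    unfolding hurwitz_def by auto
  have d: "b - a \<in> \<int> \<and> c - a \<in> \<int> \<and> d - a \<in> \<int>"
    using * Ints_diff[of "b - 1/2" "a - 1/2"] Ints_diff[of "c - 1/2" "a - 1/2"]
      Ints_diff[of "d - 1/2" "a - 1/2"] by auto
  have "2 * a \<in> \<int>"
  proof (cases "a \<in> \<int>")
    case False
    with * have "2 * (a - 1/2) + 1 \<in> \<int>" by (intro Ints_add Ints_mult) auto
    then show ?thesis by (simp add: algebra_simps)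
  qed (intro Ints_mult, auto)
  with d obtain p q r s :: int where "2 * a = p" "b - a = q" "c - a = r" "d - a = s"
    by (auto elim!: Ints_cases)
  then have "a = p/2" "b = p/2 + q" "c = p/2 + r" "d = p/2 + s" by linarith+
  with x show "\<exists>(p::int) (q::int) (r::int) (s::int). x = Quat (p/2) (p/2 + q) (p/2 + r) (p/2 + s)" by blast
next
  assume "\<exists>(p::int) (q::int) (r::int) (s::int). x = Quat (p/2) (p/2 + q) (p/2 + r) (p/2 + s)"
  then obtain p q r s :: int where x: "x = Quat (p/2) (p/2 + q) (p/2 + r) (p/2 + s)" by blast
  show "x \<in> hurwitz"
  proof (cases "even p")
    case True
    then obtain n where "p = 2 * n" by blast
    then have "p/2 \<in> \<int>" by simp
    then have "p/2 + t \<in> \<int>" for t :: int by (intro Ints_add Ints_of_int)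
    with \<open>p/2 \<in> \<int>\<close> show ?thesis unfolding hurwitz_def x by blast
  next
    case False
    then obtain n where "p = 2 * n + 1" by (blast elim: oddE)
    then have "p/2 - 1/2 = of_int n" "p/2 + t - 1/2 = of_int (n + t)" for t :: int
      by (simp_all add: field_simps)
    then have "p/2 - 1/2 \<in> \<int>" "p/2 + t - 1/2 \<in> \<int>" for t :: int
      by (metis Ints_of_int)+
    then show ?thesis unfolding hurwitz_def x by blast
  qed
qed

lemma ring_hurwitz_ring: "ring hurwitz_ring"
proof -
  have I: "Quat (p/2) (p/2 + q) (p/2 + r) (p/2 + s) \<in> hurwitz" for p q r s :: int
    unfolding hurwitz_iff by blast
  have zero: "0 \<in> hurwitz" using I[of 0 0 0 0] by (simp add: quat_defs)
  have one: "1 \<in> hurwitz" using I[of 2 "-1" "-1" "-1"] by (simp add: quat_defs)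
  have uminus: "- x \<in> hurwitz" if x: "x \<in> hurwitz" for x
  proof -
    obtain p q r s :: int where "x = Quat (p/2) (p/2 + q) (p/2 + r) (p/2 + s)"
      using x unfolding hurwitz_iff by blast
    then show ?thesis using I[of "-p" "-q" "-r" "-s"] by (simp add: quat_defs)
  qed
  have add: "x + y \<in> hurwitz" and mult: "x * y \<in> hurwitz"
    if x: "x \<in> hurwitz" and y: "y \<in> hurwitz" for x y
  proof -
    obtain p q r s :: int where x: "x = Quat (p/2) (p/2 + q) (p/2 + r) (p/2 + s)"
      using x unfolding hurwitz_iff by blast
    obtain p' q' r' s' :: int where y: "y = Quat (p'/2) (p'/2 + q') (p'/2 + r') (p'/2 + s')"
      using y unfolding hurwitz_iff by blast
    show "x + y \<in> hurwitz"
      using I[of "p + p'" "q + q'" "r + r'" "s + s'"]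
      by (simp add: quat_defs x y add_divide_distrib add_ac)
    let ?t = "q * q' + r * r' + s * s'"
    have "x * y = Quat (P/2) (P/2 + Q) (P/2 + R) (P/2 + S)"
      if "P = - (p * p') - (p * q' + q * p' + p * r' + r * p' + p * s' + s * p') - 2 * ?t"
        and "Q = p * p' + p * q' + q * p' + p * s' + r * p' + r * s' - s * r' + ?t"
        and "R = p * p' + p * r' + r * p' + p * q' + s * p' + s * q' - q * s' + ?t"
        and "S = p * p' + p * s' + s * p' + p * r' + q * p' + q * r' - r * q' + ?t"
      for P Q R S :: int
      unfolding that by (simp add: quat_defs x y field_simps)
    then show "x * y \<in> hurwitz" using I by metis
  qed
  show ?thesis
    by (rule ringI[OF abelian_groupI monoidI])
      (auto simp: hurwitz_ring_def zero one add mult algebra_simps intro!: bexI[OF _ uminus])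
qed

definition hurwitz_commutator_ideal :: "quat set" where
  "hurwitz_commutator_ideal =
    Idl\<^bsub>hurwitz_ring\<^esub> {a * b - b * a | a b. a \<in> hurwitz \<and> b \<in> hurwitz}"


section \<open>Quaternionic matrix groups\<close>

definition quat_adjoint :: "quat^2^2 \<Rightarrow> quat^2^2" where
  "quat_adjoint S = (\<chi> i j. quat_cnj (S $ j $ i))"

text \<open>Only meaningful for Hermitian matrices, on which the value is a real quaternion.\<close>

definition hermitian_det :: "quat^2^2 \<Rightarrow> quat" where
  "hermitian_det X = X $ 1 $ 1 * X $ 2 $ 2 - X $ 1 $ 2 * quat_cnj (X $ 1 $ 2)"

definition SL2_quat :: "(quat^2^2) monoid" where
  "SL2_quat = \<lparr>carrier = {S. hermitian_det (S ** quat_adjoint S) = 1}, mult = (**), one = mat 1\<rparr>"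

definition PSL2_quat :: "(quat^2^2) set monoid" where
  "PSL2_quat = SL2_quat Mod {mat 1, - mat 1}"

definition PSL2_hurwitz :: "(quat^2^2) set set" where
  "PSL2_hurwitz = {X \<in> carrier PSL2_quat. \<exists>S\<in>X. \<forall>i j. S $ i $ j \<in> hurwitz}"

text \<open>The congruence does not depend on the choice of the representative \<open>S\<close> of \<open>{S, -S}\<close>.\<close>

definition PSL2_0_hurwitz :: "(quat^2^2) set monoid" where
  "PSL2_0_hurwitz = PSL2_quat
    \<lparr>carrier := {X \<in> PSL2_hurwitz. \<exists>S\<in>X.
       (S $ 1 $ 1 * S $ 2 $ 2 - S $ 1 $ 2 * S $ 2 $ 1) - 1 \<in> hurwitz_commutator_ideal}\<rparr>"


section \<open>Semidirect products with a group of order two\<close>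

text \<open>
  \<open>G\<close> is of the form \<open>A \<rtimes> 2\<close>, in the internal sense. The action of \<open>K\<close> on \<open>N\<close> is conjugation
  in \<open>G\<close> and is not prescribed further.
\<close>

definition semidirect_by_2 :: "('a, 'c) monoid_scheme \<Rightarrow> ('b, 'd) monoid_scheme \<Rightarrow> bool" where
  "semidirect_by_2 G A \<longleftrightarrow>
    (\<exists>N K. N \<lhd> G \<and> G\<lparr>carrier := N\<rparr> \<cong> A \<and> card (rcosets\<^bsub>G\<^esub> N) = 2 \<and>
       subgroup K G \<and> card K = 2 \<and> N \<inter> K = {\<one>\<^bsub>G\<^esub>} \<and> N <#>\<^bsub>G\<^esub> K = carrier G)"

end

theory Submission
  imports Defs "HOL-Analysis.Cartesian_Space"
begin

text \<open>
  Hermitian \<open>2 \<times> 2\<close> quaternionic matrices form a real space of dimension 6 on which minus the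
  determinant is a quadratic form of signature (5,1). The Weyl group of \<open>B\<^sub>4\<^sup>+\<^sup>+\<close> acts on it by
  reflections in six roots, and a matrix \<open>S\<close> in \<open>SL\<^sub>2\<close> acts by \<open>X \<mapsto> S X S\<^sup>\<dagger>\<close>. The theorem compares
  these two actions.

  Let \<open>N\<close> be the subgroup of the even Weyl group whose words contain the generator 4 (the short root) an
  even number of times; it is a copy of \<open>W\<^sup>+(D\<^sub>4\<^sup>+\<^sup>+)\<close>. All relations that involve the generator 4 have
  even exponents, so \<open>N\<close> is well defined, normal and of index 2. The commuting reflections 4 and \<open>-1\<close> have
  an even product of order 2 outside \<open>N\<close>, which generates a complement. It remains to identify \<open>N\<close> with
  the matrix group, and this takes four facts.

  \<^item> The reflection representation is faithful (\<open>reflection_representation.faithful\<close>), by the argument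
    of Tits that an element sends a simple root to a positive or to a negative root according to its
    right descents.

  \<^item> Every element of \<open>N\<close> acts as an integral matrix of the required kind (\<open>even_word_realized\<close>).
    With the simple roots of \<open>D\<^sub>4\<close> taken as Hurwitz units, the products of two reflections in long simple
    roots come from inversions, translations and diagonal matrices.

  \<^item> Conversely every such matrix acts as an element of \<open>N\<close> (\<open>SL2_0_hurwitz_realizable\<close>). The Hurwitz
    integers are norm-Euclidean, so the group is generated by the inversion, the translations and the
    diagonal matrices with unit entries \<open>u\<close>, \<open>v\<close> where \<open>u v\<close> is congruent to 1. The commutator ideal
    consists of the quaternions with integral coordinates and even coordinate sum, so the congruence
    says that \<open>u v\<close> is one of \<open>\<plusminus>1, \<plusminus>i, \<plusminus>j, \<plusminus>k\<close>. These diagonal matrices are products of matrices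
    with diagonal \<open>(u, quat_cnj u)\<close>, each of which is a product of two reflections.

  \<^item> A matrix that acts trivially is \<open>\<plusminus>1\<close> (\<open>trivial_conjugation\<close>), so the matrix of an element of \<open>N\<close> is
    unique up to sign (\<open>realizes_unique\<close>).
\<close>

section \<open>Faithfulness of reflection representations\<close>

abbreviation word_action :: "('i \<Rightarrow> 'v \<Rightarrow> 'v) \<Rightarrow> 'i list \<Rightarrow> 'v \<Rightarrow> 'v" where
  "word_action s w x \<equiv> foldr s w x"

definition coxeter_length :: "'i set \<Rightarrow> ('i \<Rightarrow> 'i \<Rightarrow> enat) \<Rightarrow> 'i list \<Rightarrow> nat" where
  "coxeter_length I m w = (LEAST n. \<exists>u. coxeter_equiv I m w u \<and> length u = n)"

lemma coxeter_length_le: "coxeter_equiv I m w u \<Longrightarrow> coxeter_length I m w \<le> length u"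
  unfolding coxeter_length_def by (rule Least_le) blast

lemma obtain_reduced_word:
  assumes "w \<in> lists I"
  obtains u where "coxeter_equiv I m w u" "length u = coxeter_length I m w" "u \<in> lists I"
proof -
  have "\<exists>n u. coxeter_equiv I m w u \<and> length u = n"
    using coxeter_equiv.refl[OF assms] by blast
  then have "\<exists>u. coxeter_equiv I m w u \<and> length u = coxeter_length I m w"
    unfolding coxeter_length_def by (rule LeastI_ex)
  then show ?thesis using that coxeter_equiv_lists by blast
qed

lemma coxeter_length_cong: "coxeter_equiv I m u v \<Longrightarrow> coxeter_length I m u = coxeter_length I m v"
  unfolding coxeter_length_def by (metis coxeter_equiv.sym coxeter_equiv.trans)

lemma coxeter_length_append_le:
  assumes "v \<in> lists I" "u \<in> lists I"
  shows "coxeter_length I m (v @ u) \<le> coxeter_length I m v + length u"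
proof -
  obtain v' where v': "coxeter_equiv I m v v'" "length v' = coxeter_length I m v"
    using obtain_reduced_word[OF assms(1)] by metis
  from coxeter_length_le[OF coxeter_equiv_append_right[OF v'(1) assms(2)]] v'(2)
  show ?thesis by simp
qed

lemma coxeter_equiv_cancel:
  assumes "u \<in> lists I" "v \<in> lists I" "i \<in> I"
  shows "coxeter_equiv I m (u @ i # i # v) (u @ v)"
  using coxeter_equiv.square[OF assms, of m] by simp

text \<open>
  Multiplying \<open>p q = 1\<close> by the inverse of \<open>q\<close>, which is the reversed word. This turns a braid
  relation \<open>(ij)\<^sup>m = 1\<close> into the equality of the two alternating words of length \<open>m\<close>.
\<close>

lemma coxeter_equiv_rev_if_append:
  assumes "coxeter_equiv I m (p @ q) []"
  shows "coxeter_equiv I m p (rev q)"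
proof -
  have l: "p \<in> lists I" "q \<in> lists I" "rev q \<in> lists I"
    using coxeter_equiv_lists[OF assms] by auto
  have "coxeter_equiv I m (q @ rev q) []"
    using coxeter_equiv_rev_append[OF l(3)] by simp
  then have "coxeter_equiv I m (p @ q @ rev q) p"
    using coxeter_equiv_append_left[OF _ l(1)] by fastforce
  moreover have "coxeter_equiv I m (p @ q @ rev q) (rev q)"
    using coxeter_equiv_append_right[OF assms l(3)] by simp
  ultimately show ?thesis by (meson coxeter_equiv.sym coxeter_equiv.trans)
qed

lemma alternating_words_equiv:
  assumes "i \<in> I" "j \<in> I" "i \<noteq> j"
  shows "m i j = 2 \<Longrightarrow> coxeter_equiv I m [i, j] [j, i]"
    and "m i j = 3 \<Longrightarrow> coxeter_equiv I m [i, j, i] [j, i, j]"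
    and "m i j = 4 \<Longrightarrow> coxeter_equiv I m [i, j, i, j] [j, i, j, i]"
proof -
  note br = coxeter_equiv.braid[OF _ _ assms, of "[]" "[]" m, simplified]
  show "coxeter_equiv I m [i, j] [j, i]" if "m i j = 2"
    using coxeter_equiv_rev_if_append[of I m "[i, j]" "[i, j]"] br[of 2] that
    by (simp add: numeral_eq_Suc numeral_eq_enat)
  show "coxeter_equiv I m [i, j, i] [j, i, j]" if "m i j = 3"
    using coxeter_equiv_rev_if_append[of I m "[i, j, i]" "[j, i, j]"] br[of 3] that
    by (simp add: numeral_eq_Suc numeral_eq_enat)
  show "coxeter_equiv I m [i, j, i, j] [j, i, j, i]" if "m i j = 4"
    using coxeter_equiv_rev_if_append[of I m "[i, j, i, j]" "[i, j, i, j]"] br[of 4] that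
    by (simp add: numeral_eq_Suc numeral_eq_enat)
qed

text \<open>
  A representation by reflections \<open>s i\<close> in simple roots \<open>\<alpha> i\<close>, where no bond is stronger than a double
  one; a double bond may point in either direction. The predicate \<open>positive\<close> abstracts a convex
  cone that contains the simple roots and none of their negatives. Keeping the cone abstract avoids
  coordinates with respect to the simple roots.
\<close>

locale reflection_representation =
  fixes I :: "'i set" and m :: "'i \<Rightarrow> 'i \<Rightarrow> enat"
    and s :: "'i \<Rightarrow> 'v::ab_group_add \<Rightarrow> 'v" and \<alpha> :: "'i \<Rightarrow> 'v" and positive :: "'v \<Rightarrow> bool"
  assumes exponent_sym: "m i j = m j i"
    and refl_add: "i \<in> I \<Longrightarrow> s i (x + y) = s i x + s i y"
    and refl_refl: "i \<in> I \<Longrightarrow> s i (s i x) = x"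
    and refl_braid: "\<lbrakk>i \<in> I; j \<in> I; i \<noteq> j; m i j = enat k\<rbrakk> \<Longrightarrow> ((s i \<circ> s j) ^^ k) x = x"
    and refl_root: "i \<in> I \<Longrightarrow> s i (\<alpha> i) = - \<alpha> i"
    and bonds: "\<lbrakk>i \<in> I; j \<in> I; i \<noteq> j\<rbrakk> \<Longrightarrow>
        m i j = 2 \<and> s i (\<alpha> j) = \<alpha> j \<and> s j (\<alpha> i) = \<alpha> i
      \<or> m i j = 3 \<and> s i (\<alpha> j) = \<alpha> j + \<alpha> i \<and> s j (\<alpha> i) = \<alpha> i + \<alpha> j
      \<or> m i j = 4 \<and> s i (\<alpha> j) = \<alpha> j + \<alpha> i \<and> s j (\<alpha> i) = \<alpha> i + \<alpha> j + \<alpha> j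
      \<or> m i j = 4 \<and> s i (\<alpha> j) = \<alpha> j + \<alpha> i + \<alpha> i \<and> s j (\<alpha> i) = \<alpha> i + \<alpha> j"
    and positive_root: "i \<in> I \<Longrightarrow> positive (\<alpha> i)"
    and positive_add: "\<lbrakk>positive x; positive y\<rbrakk> \<Longrightarrow> positive (x + y)"
    and not_positive_neg_root: "i \<in> I \<Longrightarrow> \<not> positive (- \<alpha> i)"
begin

lemma word_action_concat_replicate:
  "word_action s (concat (replicate k [i, j])) x = ((s i \<circ> s j) ^^ k) x"
  by (induction k arbitrary: x) auto

lemma word_action_cong:
  assumes "coxeter_equiv I m u v"
  shows "word_action s u x = word_action s v x"
  using assms
proof (induction arbitrary: x rule: coxeter_equiv.induct)
  case (braid u v i j k)
  then show ?case using refl_braid by (simp add: word_action_concat_replicate)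
qed (auto simp: refl_refl)

lemma word_action_add:
  "w \<in> lists I \<Longrightarrow> word_action s w (x + y) = word_action s w x + word_action s w y"
  by (induction w) (auto simp: refl_add)

lemma refl_minus: assumes "i \<in> I" shows "s i (- x) = - s i x"
proof -
  have "s i 0 = 0" using refl_add[OF assms, of 0 0] by simp
  then show ?thesis using refl_add[OF assms, of x "- x"] by (simp add: eq_neg_iff_add_eq_0 add.commute)
qed

lemma word_action_minus: "w \<in> lists I \<Longrightarrow> word_action s w (- x) = - word_action s w x"
  by (induction w) (auto simp: refl_minus)

text \<open>
  In the dihedral group of \<open>a\<close> and \<open>b\<close>, a reduced word no form of which ends in \<open>a\<close> is alternating,
  ends in \<open>b\<close>, and is shorter than \<open>m a b\<close>: an alternating word of length \<open>m a b\<close> could be rewritten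
  to end in \<open>a\<close>. So only \<open>1\<close>, \<open>b\<close>, \<open>ab\<close> (for \<open>m a b \<ge> 3\<close>) and \<open>bab\<close> (for \<open>m a b = 4\<close>) remain, and their
  effect on \<open>\<alpha> a\<close> is computed directly.
\<close>

lemma dihedral_positive:
  assumes st: "a \<in> I" "b \<in> I" "a \<noteq> b" and u: "u \<in> lists {a, b}"
    and reduced: "\<And>u'. coxeter_equiv I m u u' \<Longrightarrow> length u \<le> length u'"
    and no_descent: "\<And>u'. coxeter_equiv I m u (u' @ [a]) \<Longrightarrow> length u < length (u' @ [a])"
  shows "word_action s u (\<alpha> a) \<in> {\<alpha> a, \<alpha> b, \<alpha> a + \<alpha> b, \<alpha> a + \<alpha> b + \<alpha> b}"
proof -
  have uI: "u \<in> lists I" using u st by auto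
  have last_ne: "u \<noteq> x @ [a]" for x
    using no_descent[of x] coxeter_equiv.refl[OF uI, of m] by auto
  have no_repeat: "u \<noteq> x @ c # c # y" for x c y
  proof
    assume "u = x @ c # c # y"
    with uI reduced[of "x @ y"] coxeter_equiv_cancel[of x I y c m] show False by auto
  qed
  have no_tail: "u \<noteq> x @ p" if "coxeter_equiv I m p (q @ [a])" "length p = length (q @ [a])" for x p q
  proof
    assume e: "u = x @ p"
    then have "coxeter_equiv I m u (x @ q @ [a])"
      using coxeter_equiv_append_left[OF that(1), of x] uI by auto
    then show False using no_descent[of "x @ q"] e that(2) by auto
  qed
  have two: "m a b = 2 \<Longrightarrow> u \<noteq> x @ [a, b]" for x
    using no_tail[of "[a, b]" "[b]"] alternating_words_equiv(1)[OF st] by simp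
  have three: "m a b = 3 \<Longrightarrow> u \<noteq> x @ [b, a, b]" for x
    using no_tail[of "[b, a, b]" "[a, b]"] alternating_words_equiv(2)[OF st(2,1), of m] st(3) exponent_sym
    by simp
  have four: "m a b = 4 \<Longrightarrow> u \<noteq> x @ [a, b, a, b]" for x
    using no_tail[of "[a, b, a, b]" "[b, a, b]"] alternating_words_equiv(3)[OF st] by simp
  have ends: "x = [] \<or> (\<exists>y. x = y @ [a]) \<or> (\<exists>y. x = y @ [b])" if "u = x @ z" for x z
    using u that by (cases x rule: rev_cases) auto
  consider "u = []" | "u = [b]" | "u = [a, b]" "m a b \<noteq> 2" | "u = [b, a, b]" "m a b \<noteq> 2" "m a b \<noteq> 3"
  proof -
    assume A: "u = [] \<Longrightarrow> thesis" "u = [b] \<Longrightarrow> thesis" "u = [a, b] \<Longrightarrow> m a b \<noteq> 2 \<Longrightarrow> thesis"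
      "u = [b, a, b] \<Longrightarrow> m a b \<noteq> 2 \<Longrightarrow> m a b \<noteq> 3 \<Longrightarrow> thesis"
    show thesis
    proof (cases "u = []")
      case False
      then obtain x1 where x1: "u = x1 @ [b]" using ends[of u "[]"] last_ne by auto
      show thesis
      proof (cases "x1 = []")
        case False
        then obtain x2 where x2: "u = x2 @ [a, b]" using ends[of x1 "[b]"] no_repeat[of _ b "[]"] x1 by auto
        then have n2: "m a b \<noteq> 2" using two by blast
        show thesis
        proof (cases "x2 = []")
          case False
          then obtain x3 where x3: "u = x3 @ [b, a, b]"
            using ends[of x2 "[a, b]"] no_repeat[of _ a "[b]"] x2 by auto
          then have n3: "m a b \<noteq> 3" using three by blast
          then have n4: "m a b = 4" using n2 bonds[OF st] by auto
          have "x3 = []"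
            using ends[of x3 "[b, a, b]"] no_repeat[of _ b "[a, b]"] x3 four[OF n4] by auto
          then show thesis using A(4) n2 n3 x3 by simp
        qed (use A(3) n2 x2 in simp)
      qed (use A(2) x1 in simp)
    qed (use A(1) in simp)
  qed
  then show ?thesis
    using bonds[OF st] st
    by cases (auto simp: refl_root refl_add refl_minus algebra_simps)
qed

text \<open>
  The argument of Tits, by induction on the length of \<open>w\<close>. Let \<open>b\<close> be the last letter of a reduced
  word for \<open>w\<close>. Among the length-additive factorizations \<open>w = v u\<close> with \<open>u\<close> in the dihedral group
  of \<open>a\<close> and \<open>b\<close>, take one with \<open>v\<close> shortest. Then neither \<open>a\<close> nor \<open>b\<close> shortens \<open>v\<close> from the right, so
  \<open>v\<close> maps \<open>\<alpha> a\<close> and \<open>\<alpha> b\<close> into the cone by induction, and \<open>u\<close> maps \<open>\<alpha> a\<close> to a nonnegative combination of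
  these two roots.
\<close>

lemma positive_if_not_descent:
  assumes "w \<in> lists I" "a \<in> I" "coxeter_length I m w \<le> coxeter_length I m (w @ [a])"
  shows "positive (word_action s w (\<alpha> a))"
  using assms
proof (induction "coxeter_length I m w" arbitrary: w a rule: less_induct)
  case less
  let ?l = "coxeter_length I m" and ?eq = "coxeter_equiv I m"
  note w = less.prems(1) and a = less.prems(2)
  obtain u0 where u0: "?eq w u0" "length u0 = ?l w" "u0 \<in> lists I"
    using obtain_reduced_word[OF w] by metis
  show ?case
  proof (cases u0 rule: rev_cases)
    case Nil
    then show ?thesis using u0 word_action_cong a positive_root by simp
  next
    case (snoc u1 b)
    have u1: "u1 \<in> lists I" and b: "b \<in> I" using u0(3) snoc by auto
    have ab: "a \<noteq> b"
    proof
      assume "a = b"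
      then have "?eq (w @ [a]) (u1 @ [a, a])"
        using coxeter_equiv_append_right[OF u0(1), of "[a]"] a snoc by simp
      moreover have "?eq (u1 @ [a, a]) u1" using coxeter_equiv_cancel[OF u1 _ a, of "[]"] by simp
      ultimately have "?l (w @ [a]) \<le> length u1" by (meson coxeter_equiv.trans coxeter_length_le)
      then show False using less.prems(3) u0(2) snoc by simp
    qed
    define A where "A = (\<lambda>v u. v \<in> lists I \<and> u \<in> lists {a, b} \<and> ?eq w (v @ u) \<and> ?l v + length u = ?l w)"
    have bound: "?l w \<le> ?l v + length u" if "?eq w (v @ u)" for v u
      using coxeter_length_cong[OF that] coxeter_length_append_le[of v I u m] coxeter_equiv_lists[OF that] by auto
    have lu1: "?l u1 + 1 = ?l w"
      using coxeter_length_le[OF coxeter_equiv.refl[OF u1], of m] bound[of u1 "[b]"] u0 snoc by simp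
    have A1: "A u1 [b]" using u1 u0 snoc lu1 by (simp add: A_def)
    obtain v u where vu: "A v u" and min: "\<And>v' u'. A v' u' \<Longrightarrow> ?l v \<le> ?l v'"
      using ex_has_least_nat[of "\<lambda>v. \<exists>u. A v u" u1 ?l] A1 by blast
    have v: "v \<in> lists I" and uab: "u \<in> lists {a, b}" and uI: "u \<in> lists I"
      and wvu: "?eq w (v @ u)" and lvu: "?l v + length u = ?l w"
      using vu a b by (auto simp: A_def)
    have vlt: "?l v < ?l w" using min[OF A1] lu1 by simp
    \<comment> \<open>A letter \<open>c\<close> that shortens \<open>v\<close> could be moved over to \<open>u\<close>, against minimality.\<close>
    have "?l v \<le> ?l (v @ [c])" if c: "c \<in> {a, b}" for c
    proof (rule ccontr)
      assume *: "\<not> ?thesis"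
      have cI: "c \<in> I" using c a b by auto
      have "?eq (v @ c # c # u) (v @ u)" by (rule coxeter_equiv_cancel[OF v uI cI])
      then have e: "?eq w ((v @ [c]) @ c # u)" using wvu by (auto intro: coxeter_equiv.sym coxeter_equiv.trans)
      have "A (v @ [c]) (c # u)" using v cI c uab e bound[OF e] * lvu by (auto simp: A_def)
      from min[OF this] * show False by simp
    qed
    then have pos: "positive (word_action s v (\<alpha> a))" "positive (word_action s v (\<alpha> b))"
      using less.hyps[OF vlt v] a b by auto
    have "word_action s u (\<alpha> a) \<in> {\<alpha> a, \<alpha> b, \<alpha> a + \<alpha> b, \<alpha> a + \<alpha> b + \<alpha> b}"
    proof (rule dihedral_positive[OF a b ab uab])
      fix u' assume "?eq u u'"
      then have "?eq w (v @ u')"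
        using coxeter_equiv_append_left[OF _ v] wvu coxeter_equiv.trans by blast
      then show "length u \<le> length u'" using bound[of v u'] lvu by simp
    next
      fix u' assume e: "?eq u (u' @ [a])"
      have u': "u' \<in> lists I" using coxeter_equiv_lists[OF e] by auto
      have "?eq (w @ [a]) ((v @ u' @ [a]) @ [a])"
        by (rule coxeter_equiv_append_right[OF coxeter_equiv.trans[OF wvu coxeter_equiv_append_left[OF e v]]])
          (use a in simp)
      moreover have "?eq ((v @ u' @ [a]) @ [a]) (v @ u')"
        using coxeter_equiv_cancel[of "v @ u'" I "[]" a m] v u' a by simp
      ultimately have "?l (w @ [a]) = ?l (v @ u')" using coxeter_length_cong coxeter_equiv.trans by blast
      then show "length u < length (u' @ [a])"
        using coxeter_length_append_le[OF v u', of m] less.prems(3) lvu by simp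
    qed
    then show ?thesis
      using pos by (auto simp: word_action_cong[OF wvu] word_action_add[OF v] intro!: positive_add)
  qed
qed

text \<open>
  If a reduced word \<open>v a\<close> fixed \<open>\<alpha> a\<close>, then \<open>v\<close> would map \<open>\<alpha> a\<close> to \<open>- \<alpha> a\<close>, although \<open>a\<close> is not a right
  descent of \<open>v\<close>.
\<close>

theorem faithful:
  assumes w: "w \<in> lists I" and fixed: "\<And>i. i \<in> I \<Longrightarrow> word_action s w (\<alpha> i) = \<alpha> i"
  shows "coxeter_equiv I m w []"
proof -
  obtain u where u: "coxeter_equiv I m w u" "length u = coxeter_length I m w" "u \<in> lists I"
    using obtain_reduced_word[OF w] by metis
  show ?thesis
  proof (cases u rule: rev_cases)
    case Nil
    then show ?thesis using u by simp
  next
    case (snoc v a)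
    then have v: "v \<in> lists I" and a: "a \<in> I" using u(3) by auto
    have "coxeter_length I m v \<le> length v"
      by (rule coxeter_length_le[OF coxeter_equiv.refl[OF v]])
    then have "coxeter_length I m v \<le> coxeter_length I m (v @ [a])"
      using u snoc coxeter_length_cong[OF u(1)] by simp
    then have "positive (word_action s v (\<alpha> a))" by (rule positive_if_not_descent[OF v a])
    moreover have "- word_action s v (\<alpha> a) = \<alpha> a"
      using fixed[OF a] word_action_cong[OF u(1), of "\<alpha> a"] snoc
      by (simp add: word_action_minus[OF v] refl_root[OF a])
    ultimately show ?thesis using not_positive_neg_root[OF a] by (metis add.inverse_inverse)
  qed
qed

end

section \<open>Quaternions and Hermitian matrices\<close>

lemma quat_eq_iff:
  "x = y \<longleftrightarrow> quat_re x = quat_re y \<and> quat_i x = quat_i y \<and> quat_j x = quat_j y \<and> quat_k x = quat_k y"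
  by (cases x; cases y) auto

definition quat_norm :: "quat \<Rightarrow> real" where
  "quat_norm x = (quat_re x)\<^sup>2 + (quat_i x)\<^sup>2 + (quat_j x)\<^sup>2 + (quat_k x)\<^sup>2"

definition quat_of_real :: "real \<Rightarrow> quat" where
  "quat_of_real r = Quat r 0 0 0"

lemma quat_sel [simp]:
  "quat_re 0 = 0" "quat_i 0 = 0" "quat_j 0 = 0" "quat_k 0 = 0"
  "quat_re 1 = 1" "quat_i 1 = 0" "quat_j 1 = 0" "quat_k 1 = 0"
  "quat_re (x + y) = quat_re x + quat_re y" "quat_i (x + y) = quat_i x + quat_i y"
  "quat_j (x + y) = quat_j x + quat_j y" "quat_k (x + y) = quat_k x + quat_k y"
  "quat_re (x - y) = quat_re x - quat_re y" "quat_i (x - y) = quat_i x - quat_i y"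
  "quat_j (x - y) = quat_j x - quat_j y" "quat_k (x - y) = quat_k x - quat_k y"
  "quat_re (- x) = - quat_re x" "quat_i (- x) = - quat_i x"
  "quat_j (- x) = - quat_j x" "quat_k (- x) = - quat_k x"
  "quat_re (quat_cnj x) = quat_re x" "quat_i (quat_cnj x) = - quat_i x"
  "quat_j (quat_cnj x) = - quat_j x" "quat_k (quat_cnj x) = - quat_k x"
  "quat_re (quat_of_real r) = r" "quat_i (quat_of_real r) = 0"
  "quat_j (quat_of_real r) = 0" "quat_k (quat_of_real r) = 0"
  by (simp_all add: quat_defs quat_cnj_def quat_of_real_def)

lemma quat_times_sel:
  "quat_re (x * y) = quat_re x * quat_re y - quat_i x * quat_i y - quat_j x * quat_j y - quat_k x * quat_k y"
  "quat_i (x * y) = quat_re x * quat_i y + quat_i x * quat_re y + quat_j x * quat_k y - quat_k x * quat_j y"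
  "quat_j (x * y) = quat_re x * quat_j y - quat_i x * quat_k y + quat_j x * quat_re y + quat_k x * quat_i y"
  "quat_k (x * y) = quat_re x * quat_k y + quat_i x * quat_j y - quat_j x * quat_i y + quat_k x * quat_re y"
  by (simp_all add: quat_defs)

lemma quat_cnj_simps [simp]:
  "quat_cnj (quat_cnj x) = x" "quat_cnj 0 = 0" "quat_cnj 1 = 1"
  "quat_cnj (x + y) = quat_cnj x + quat_cnj y" "quat_cnj (x - y) = quat_cnj x - quat_cnj y"
  "quat_cnj (- x) = - quat_cnj x" "quat_cnj (x * y) = quat_cnj y * quat_cnj x"
  "quat_cnj (quat_of_real r) = quat_of_real r"
  by (simp_all add: quat_eq_iff quat_times_sel algebra_simps)

lemma quat_of_real_simps [simp]:
  "quat_of_real 0 = 0" "quat_of_real 1 = 1" "quat_of_real (r + t) = quat_of_real r + quat_of_real t"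
  "quat_of_real (r - t) = quat_of_real r - quat_of_real t"
  "quat_of_real (r * t) = quat_of_real r * quat_of_real t"
  "quat_of_real r = quat_of_real t \<longleftrightarrow> r = t"
  "quat_of_real r = 0 \<longleftrightarrow> r = 0" "quat_of_real r = 1 \<longleftrightarrow> r = 1"
  by (auto simp: quat_eq_iff quat_times_sel)

lemma quat_of_real_commute: "quat_of_real r * x = x * quat_of_real r"
  by (simp add: quat_eq_iff quat_times_sel)

lemma quat_mult_cnj: "x * quat_cnj x = quat_of_real (quat_norm x)" "quat_cnj x * x = quat_of_real (quat_norm x)"
  by (simp_all add: quat_eq_iff quat_times_sel quat_norm_def power2_eq_square)

lemma quat_norm_simps [simp]:
  "quat_norm 0 = 0" "quat_norm 1 = 1" "quat_norm (- x) = quat_norm x" "quat_norm (quat_cnj x) = quat_norm x"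
  by (simp_all add: quat_norm_def)

lemma quat_norm_mult: "quat_norm (x * y) = quat_norm x * quat_norm y"
  by (simp add: quat_norm_def quat_times_sel power2_eq_square algebra_simps)

lemma quat_norm_nonneg [simp]: "quat_norm x \<ge> 0"
  by (simp add: quat_norm_def)

lemma quat_norm_eq_0_iff [simp]: "quat_norm x = 0 \<longleftrightarrow> x = 0"
  by (auto simp: quat_norm_def quat_eq_iff add_nonneg_eq_0_iff)

definition mat2 :: "quat \<Rightarrow> quat \<Rightarrow> quat \<Rightarrow> quat \<Rightarrow> quat^2^2" where
  "mat2 a b c d = (\<chi> i j. if i = 1 then if j = 1 then a else b else if j = 1 then c else d)"

lemma mat2_nth [simp]:
  "mat2 a b c d $ 1 $ 1 = a" "mat2 a b c d $ 1 $ 2 = b"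
  "mat2 a b c d $ 2 $ 1 = c" "mat2 a b c d $ 2 $ 2 = d"
  by (simp_all add: mat2_def)

lemma mat2_ext:
  fixes S T :: "quat^2^2"
  shows "S = T \<longleftrightarrow> S $ 1 $ 1 = T $ 1 $ 1 \<and> S $ 1 $ 2 = T $ 1 $ 2 \<and> S $ 2 $ 1 = T $ 2 $ 1 \<and> S $ 2 $ 2 = T $ 2 $ 2"
  by (auto simp: vec_eq_iff forall_2)

lemma mat2_cases [cases type]:
  obtains a b c d where "S = mat2 a b c d"
  using mat2_ext[of S "mat2 (S$1$1) (S$1$2) (S$2$1) (S$2$2)"] by auto

lemma mat2_simps [simp]:
  "mat2 a b c d = mat2 a' b' c' d' \<longleftrightarrow> a = a' \<and> b = b' \<and> c = c' \<and> d = d'"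
  "mat2 a b c d ** mat2 a' b' c' d' = mat2 (a * a' + b * c') (a * b' + b * d') (c * a' + d * c') (c * b' + d * d')"
  "- mat2 a b c d = mat2 (- a) (- b) (- c) (- d)"
  "quat_adjoint (mat2 a b c d) = mat2 (quat_cnj a) (quat_cnj c) (quat_cnj b) (quat_cnj d)"
  by (auto simp: mat2_ext matrix_matrix_mult_def sum_2 quat_adjoint_def)

lemma mat_1_eq_mat2: "mat 1 = mat2 1 0 0 1"
  by (simp add: mat2_ext mat_def)

lemma quat_adjoint_mult: "quat_adjoint (S ** T) = quat_adjoint T ** quat_adjoint S"
  by (cases S; cases T) simp

lemma matrix_minus_mult:
  fixes S T :: "quat^2^2"
  shows "(- S) ** T = - (S ** T)" "S ** (- T) = - (S ** T)" "quat_adjoint (- S) = - quat_adjoint S"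
  by (cases S; cases T; simp)+

text \<open>
  The triple \<open>(p, q, r)\<close> holds the diagonal entries \<open>p\<close>, \<open>r\<close> and the upper right entry \<open>q\<close> of a Hermitian
  matrix.
\<close>

type_synonym hermitian = "real \<times> quat \<times> real"

fun hermitian_matrix :: "hermitian \<Rightarrow> quat^2^2" where
  "hermitian_matrix (p, q, r) = mat2 (quat_of_real p) q (quat_cnj q) (quat_of_real r)"

lemma hermitian_matrix_inject: "hermitian_matrix x = hermitian_matrix y \<longleftrightarrow> x = y"
  by (cases x; cases y) auto

definition conjugate :: "quat^2^2 \<Rightarrow> hermitian \<Rightarrow> quat^2^2" where
  "conjugate S x = S ** hermitian_matrix x ** quat_adjoint S"

text \<open>
  The diagonal entries of \<open>S S\<^sup>\<dagger>\<close> are the squared lengths of the rows of \<open>S\<close>, the off-diagonal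
  entry is their quaternionic inner product.
\<close>

lemma hermitian_det_mult_adjoint:
  "hermitian_det (mat2 a b c d ** quat_adjoint (mat2 a b c d)) = 1 \<longleftrightarrow>
    (quat_norm a + quat_norm b) * (quat_norm c + quat_norm d) - quat_norm (a * quat_cnj c + b * quat_cnj d) = 1"
proof -
  have "hermitian_det (mat2 a b c d ** quat_adjoint (mat2 a b c d)) =
    quat_of_real ((quat_norm a + quat_norm b) * (quat_norm c + quat_norm d) - quat_norm (a * quat_cnj c + b * quat_cnj d))"
    by (simp add: hermitian_det_def quat_mult_cnj(1) del: quat_cnj_simps(4,7))
  then show ?thesis by (simp only: quat_of_real_simps(8))
qed

text \<open>
  Fixing the two diagonal matrix units forces \<open>T\<close> to be diagonal with entries of norm 1. Fixing the
  off-diagonal matrices then forces the two entries to be equal and to commute with all quaternions,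
  so they are real.
\<close>

lemma trivial_conjugation:
  assumes "\<And>x. conjugate T x = hermitian_matrix x"
  shows "T = mat 1 \<or> T = - mat 1"
proof (cases T)
  case T: (1 t u v w)
  have e: "mat2 t u v w ** hermitian_matrix x ** quat_adjoint (mat2 t u v w) = hermitian_matrix x" for x
    using assms[of x] unfolding conjugate_def T .
  have v: "v = 0" and nt: "quat_norm t = 1"
    using e[of "(1, 0, 0)"] by (simp_all add: quat_mult_cnj)
  have u: "u = 0" and nw: "quat_norm w = 1"
    using e[of "(0, 0, 1)"] by (simp_all add: quat_mult_cnj)
  have q: "t * q * quat_cnj w = q" for q
    using e[of "(0, q, 0)"] u v by simp
  have "t * (quat_cnj w * w) = w" using q[of 1] by (simp flip: mult.assoc)
  then have tw: "t = w" using nw by (simp add: quat_mult_cnj)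
  have "t * q * (quat_cnj t * t) = q * t" for q
    using q[of q] tw by (metis mult.assoc)
  then have c: "t * q = q * t" for q by (simp add: quat_mult_cnj nt)
  have "quat_i t = 0 \<and> quat_j t = 0 \<and> quat_k t = 0"
    using c[of "Quat 0 1 0 0"] c[of "Quat 0 0 1 0"] by (simp add: quat_eq_iff quat_times_sel)
  with nt have "t = 1 \<or> t = -1" by (auto simp: quat_norm_def quat_eq_iff power2_eq_1_iff)
  then show ?thesis using T u v tw by (auto simp: mat_1_eq_mat2)
qed

section \<open>The geometric representation of B4++ on Hermitian matrices\<close>

text \<open>
  The polarization of minus the determinant, scaled such that a root of determinant \<open>-1\<close> has squared
  length 2. It has signature (5,1).
\<close>

fun lorentz_form :: "hermitian \<Rightarrow> hermitian \<Rightarrow> real" where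
  "lorentz_form (p, q, r) (p', q', r') = 2 * quat_re (q * quat_cnj q') - p * r' - r * p'"

fun hermitian_scale :: "real \<Rightarrow> hermitian \<Rightarrow> hermitian" where
  "hermitian_scale t (p, q, r) = (t * p, quat_of_real t * q, t * r)"

definition reflect :: "hermitian \<Rightarrow> hermitian \<Rightarrow> hermitian" where
  "reflect a x = x - hermitian_scale (2 * lorentz_form x a / lorentz_form a a) a"

text \<open>
  The roots of the nodes 1 to 4 lie in the quaternion coordinate. They are simple roots of a root system
  \<open>B\<^sub>4\<close> whose long roots are the 24 Hurwitz units and whose highest root is the quaternion 1. Reflection 4 swaps the
  coordinates of \<open>j\<close> and \<open>k\<close>, so roots 1, 2, 3 and the image \<open>k\<close> of root 3 are simple roots of \<open>D\<^sub>4\<close>. The roots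
  0 and \<open>-1\<close> are the affine and the over-extended root, built from the highest root and null vectors.
\<close>

definition B4pp_root :: "int \<Rightarrow> hermitian" where
  "B4pp_root i =
    (if i = -1 then (1, 0, -1)
     else if i = 0 then (-1, -1, 0)
     else if i = 1 then (0, Quat (1/2) (-1/2) (-1/2) (-1/2), 0)
     else if i = 2 then (0, Quat 0 1 0 0, 0)
     else if i = 3 then (0, Quat 0 0 1 0, 0)
     else (0, Quat 0 0 (-1/2) (1/2), 0))"

definition B4pp_reflection :: "int \<Rightarrow> hermitian \<Rightarrow> hermitian" where
  "B4pp_reflection i = reflect (B4pp_root i)"

lemma B4pp_reflection_simps:
  "B4pp_reflection (-1) (p, Quat a b c d, r) = (r, Quat a b c d, p)"
  "B4pp_reflection 0 (p, Quat a b c d, r) = (p + r - 2 * a, Quat (r - a) b c d, r)"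
  "B4pp_reflection 1 (p, Quat a b c d, r) =
    (p, Quat ((a + b + c + d) / 2) ((a + b - c - d) / 2) ((a - b + c - d) / 2) ((a - b - c + d) / 2), r)"
  "B4pp_reflection 2 (p, Quat a b c d, r) = (p, Quat a (- b) c d, r)"
  "B4pp_reflection 3 (p, Quat a b c d, r) = (p, Quat a b (- c) d, r)"
  "B4pp_reflection 4 (p, Quat a b c d, r) = (p, Quat a b d c, r)"
  by (simp_all add: B4pp_reflection_def reflect_def B4pp_root_def quat_eq_iff quat_times_sel field_simps)

text \<open>
  The left-hand sides are, up to positive factors, the coefficients of the vector with respect to
  the simple roots \<open>-1\<close>, 0, 1, 2, 3, 4.
\<close>

fun B4pp_positive :: "hermitian \<Rightarrow> bool" where
  "B4pp_positive (p, Quat a b c d, r) \<longleftrightarrow>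
    - r \<ge> 0 \<and> - r - p \<ge> 0 \<and> a - r - p \<ge> 0 \<and> b + (a - r - p) \<ge> 0 \<and>
    c + d + 2 * (a - r - p) \<ge> 0 \<and> d + (a - r - p) \<ge> 0"

abbreviation B4pp_action :: "int list \<Rightarrow> hermitian \<Rightarrow> hermitian" where
  "B4pp_action \<equiv> word_action B4pp_reflection"

abbreviation B4pp_equiv :: "int list \<Rightarrow> int list \<Rightarrow> bool" where
  "B4pp_equiv \<equiv> coxeter_equiv B4pp_nodes (coxeter_exponent B4pp_cartan)"

lemma B4pp_nodes_eq: "B4pp_nodes = {-1, 0, 1, 2, 3, 4}"
  by (auto simp: B4pp_nodes_def)

lemma hermitian_exhaust:
  obtains p a b c d r where "x = (p, Quat a b c d, r)"
  by (metis prod_cases3 quat.exhaust)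

text \<open>
  All conditions are computations in coordinates, one for each node or ordered pair of nodes.
\<close>

interpretation B4pp: reflection_representation B4pp_nodes "coxeter_exponent B4pp_cartan"
  B4pp_reflection B4pp_root B4pp_positive
proof
  show "coxeter_exponent B4pp_cartan i j = coxeter_exponent B4pp_cartan j i" for i j
    by (simp add: coxeter_exponent_def mult.commute)
  show "B4pp_reflection i (x + y) = B4pp_reflection i x + B4pp_reflection i y" if "i \<in> B4pp_nodes" for i x y
    using that unfolding B4pp_nodes_eq
    by (cases x rule: hermitian_exhaust; cases y rule: hermitian_exhaust)
      (auto simp: B4pp_reflection_simps quat_defs field_simps)
  show "B4pp_reflection i (B4pp_reflection i x) = x" if "i \<in> B4pp_nodes" for i x
    using that unfolding B4pp_nodes_eq
    by (cases x rule: hermitian_exhaust) (auto simp: B4pp_reflection_simps field_simps)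
  show "((B4pp_reflection i \<circ> B4pp_reflection j) ^^ k) x = x"
    if "i \<in> B4pp_nodes" "j \<in> B4pp_nodes" "i \<noteq> j" "coxeter_exponent B4pp_cartan i j = enat k" for i j k x
    using that unfolding B4pp_nodes_eq
    by (cases x rule: hermitian_exhaust)
      (auto simp: coxeter_exponent_def B4pp_cartan_def doubleton_eq_iff B4pp_reflection_simps field_simps
        numeral_eq_enat numeral_eq_Suc)
  show "B4pp_reflection i (B4pp_root i) = - B4pp_root i" if "i \<in> B4pp_nodes" for i
    using that unfolding B4pp_nodes_eq
    by (auto simp: B4pp_root_def B4pp_reflection_simps quat_defs)
  show "coxeter_exponent B4pp_cartan i j = 2 \<and> B4pp_reflection i (B4pp_root j) = B4pp_root j \<and>
        B4pp_reflection j (B4pp_root i) = B4pp_root i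
    \<or> coxeter_exponent B4pp_cartan i j = 3 \<and> B4pp_reflection i (B4pp_root j) = B4pp_root j + B4pp_root i \<and>
        B4pp_reflection j (B4pp_root i) = B4pp_root i + B4pp_root j
    \<or> coxeter_exponent B4pp_cartan i j = 4 \<and> B4pp_reflection i (B4pp_root j) = B4pp_root j + B4pp_root i \<and>
        B4pp_reflection j (B4pp_root i) = B4pp_root i + B4pp_root j + B4pp_root j
    \<or> coxeter_exponent B4pp_cartan i j = 4 \<and>
        B4pp_reflection i (B4pp_root j) = B4pp_root j + B4pp_root i + B4pp_root i \<and>
        B4pp_reflection j (B4pp_root i) = B4pp_root i + B4pp_root j"
    if "i \<in> B4pp_nodes" "j \<in> B4pp_nodes" "i \<noteq> j" for i j
    using that unfolding B4pp_nodes_eq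
    by (auto simp: coxeter_exponent_def B4pp_cartan_def doubleton_eq_iff B4pp_root_def B4pp_reflection_simps quat_defs)
  show "B4pp_positive (B4pp_root i)" "\<not> B4pp_positive (- B4pp_root i)" if "i \<in> B4pp_nodes" for i
    using that unfolding B4pp_nodes_eq by (auto simp: B4pp_root_def quat_defs)
  show "B4pp_positive (x + y)" if "B4pp_positive x" "B4pp_positive y" for x y
    using that
    by (cases x rule: hermitian_exhaust; cases y rule: hermitian_exhaust) (auto simp: quat_defs)
qed

section \<open>Hurwitz integers\<close>

lemma hurwitz_closed [simp, intro]:
  "0 \<in> hurwitz" "1 \<in> hurwitz"
  "x \<in> hurwitz \<Longrightarrow> y \<in> hurwitz \<Longrightarrow> x + y \<in> hurwitz"
  "x \<in> hurwitz \<Longrightarrow> y \<in> hurwitz \<Longrightarrow> x * y \<in> hurwitz"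
proof -
  interpret R: ring hurwitz_ring by (rule ring_hurwitz_ring)
  show "0 \<in> hurwitz" "1 \<in> hurwitz" using R.zero_closed R.one_closed by (simp_all add: hurwitz_ring_def)
  show "x \<in> hurwitz \<Longrightarrow> y \<in> hurwitz \<Longrightarrow> x + y \<in> hurwitz" using R.a_closed[of x y] by (simp add: hurwitz_ring_def)
  show "x \<in> hurwitz \<Longrightarrow> y \<in> hurwitz \<Longrightarrow> x * y \<in> hurwitz" using R.m_closed[of x y] by (simp add: hurwitz_ring_def)
qed

lemma hurwitz_integral: "Quat (of_int a) (of_int b) (of_int c) (of_int d) \<in> hurwitz"
  by (auto simp: hurwitz_def)

lemma hurwitz_half_integral:
  "Quat (of_int a + 1/2) (of_int b + 1/2) (of_int c + 1/2) (of_int d + 1/2) \<in> hurwitz"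
  by (auto simp: hurwitz_def)

lemma hurwitz_obtain:
  assumes "x \<in> hurwitz"
  obtains p q r s :: int where "x = Quat (p/2) (p/2 + q) (p/2 + r) (p/2 + s)"
  using assms unfolding hurwitz_iff by blast

lemma hurwitz_uminus [simp, intro]: "x \<in> hurwitz \<Longrightarrow> - x \<in> hurwitz"
  using hurwitz_closed(4)[of "- 1" x] hurwitz_integral[of "-1" 0 0 0] by (simp add: quat_defs)

lemma hurwitz_diff [simp, intro]: "x \<in> hurwitz \<Longrightarrow> y \<in> hurwitz \<Longrightarrow> x - y \<in> hurwitz"
  using hurwitz_closed(3)[of x "- y"] by simp

lemma hurwitz_cnj [simp, intro]: assumes "x \<in> hurwitz" shows "quat_cnj x \<in> hurwitz"
proof -
  obtain p q r s :: int where x: "x = Quat (p/2) (p/2 + q) (p/2 + r) (p/2 + s)"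
    using assms by (rule hurwitz_obtain)
  have "quat_cnj x = Quat (p/2) (p/2 + of_int (- p - q)) (p/2 + of_int (- p - r)) (p/2 + of_int (- p - s))"
    unfolding x by (simp add: quat_cnj_def)
  then show ?thesis unfolding hurwitz_iff by blast
qed

lemma quat_norm_hurwitz: assumes "x \<in> hurwitz" shows "\<exists>n::nat. quat_norm x = real n"
proof -
  obtain p q r s :: int where x: "x = Quat (p/2) (p/2 + q) (p/2 + r) (p/2 + s)"
    using assms by (rule hurwitz_obtain)
  have "quat_norm x = of_int (p * p + p * (q + r + s) + q * q + r * r + s * s)"
    unfolding x by (simp add: quat_norm_def power2_eq_square field_simps)
  then have "quat_norm x \<in> \<int>" by (metis Ints_of_int)
  then have "quat_norm x \<in> \<nat>" using quat_norm_nonneg Nats_altdef2 by blast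
  then show ?thesis by (auto elim: Nats_cases)
qed

text \<open>
  Rounding each coordinate leaves a remainder of norm at most 1. The value 1 occurs only if all four
  coordinates are halves of odd integers, and then the quaternion is itself a Hurwitz integer. This is what
  makes the Hurwitz integers, unlike the quaternions with integral coordinates, norm-Euclidean.
\<close>

lemma hurwitz_approximation: "\<exists>h\<in>hurwitz. quat_norm (x - h) < 1"
proof -
  obtain a b c d where x: "x = Quat a b c d" by (cases x)
  have r: "(t - round t)\<^sup>2 \<le> 1/4" for t :: real
    using abs_le_square_iff[of "t - round t" "1/2"] of_int_round_abs_le[of t]
    by (simp add: power_divide abs_minus_commute)
  have half: "t - 1/2 \<in> \<int>" if "(t - round t)\<^sup>2 = 1/4" for t :: real
  proof -
    have "(t - round t)\<^sup>2 = (1/2)\<^sup>2" using that by (simp add: power_divide)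
    then have "t - 1/2 = of_int (round t) \<or> t - 1/2 = of_int (round t - 1)"
      unfolding power2_eq_iff by auto
    then show ?thesis by (metis Ints_of_int)
  qed
  let ?h = "Quat (round a) (round b) (round c) (round d)"
  have n: "quat_norm (x - ?h) = (a - round a)\<^sup>2 + (b - round b)\<^sup>2 + (c - round c)\<^sup>2 + (d - round d)\<^sup>2"
    by (simp add: quat_norm_def x)
  show ?thesis
  proof (cases "quat_norm (x - ?h) < 1")
    case True
    then show ?thesis using hurwitz_integral by blast
  next
    case False
    then have "(a - round a)\<^sup>2 = 1/4" "(b - round b)\<^sup>2 = 1/4" "(c - round c)\<^sup>2 = 1/4" "(d - round d)\<^sup>2 = 1/4"
      using n r[of a] r[of b] r[of c] r[of d] by linarith+
    then have "x \<in> hurwitz" using half unfolding hurwitz_def x by blast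
    then show ?thesis by (intro bexI[of _ x]) auto
  qed
qed

lemma hurwitz_division:
  assumes c: "c \<noteq> 0"
  shows "\<exists>h\<in>hurwitz. quat_norm (a - h * c) < quat_norm c"
proof -
  have n: "quat_norm c > 0" using c quat_norm_nonneg[of c] quat_norm_eq_0_iff[of c] by linarith
  define y where "y = a * quat_cnj c * quat_of_real (1 / quat_norm c)"
  have "y * c = a * (quat_cnj c * c) * quat_of_real (1 / quat_norm c)"
    unfolding y_def by (simp add: mult.assoc quat_of_real_commute)
  also have "\<dots> = a * quat_of_real (quat_norm c * (1 / quat_norm c))"
    by (simp only: quat_mult_cnj mult.assoc quat_of_real_simps)
  finally have y: "y * c = a" using c by simp
  obtain h where h: "h \<in> hurwitz" "quat_norm (y - h) < 1" using hurwitz_approximation by blast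
  have "quat_norm (a - h * c) = quat_norm (y - h) * quat_norm c"
    unfolding y[symmetric] by (simp flip: quat_norm_mult add: left_diff_distrib)
  also have "\<dots> < quat_norm c" using h(2) n by simp
  finally show ?thesis using h(1) by blast
qed

lemma sum_four_squares_eq_1:
  fixes a b c d :: int
  assumes "a\<^sup>2 + b\<^sup>2 + c\<^sup>2 + d\<^sup>2 = 1"
  shows "(a, b, c, d) \<in> {(1,0,0,0), (-1,0,0,0), (0,1,0,0), (0,-1,0,0), (0,0,1,0), (0,0,-1,0), (0,0,0,1), (0,0,0,-1)}"
proof -
  have *: "t \<in> {-1, 0, 1}" if "t\<^sup>2 \<le> 1" for t :: int
  proof -
    have "\<bar>t\<bar> \<le> 1" using that abs_le_square_iff[of t 1] by simp
    then show ?thesis by auto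
  qed
  have "a\<^sup>2 \<ge> 0" "b\<^sup>2 \<ge> 0" "c\<^sup>2 \<ge> 0" "d\<^sup>2 \<ge> 0" by simp_all
  then have "a \<in> {-1, 0, 1}" "b \<in> {-1, 0, 1}" "c \<in> {-1, 0, 1}" "d \<in> {-1, 0, 1}"
    using assms by (intro *; linarith)+
  then show ?thesis using assms by (elim insertE emptyE; hypsubst; simp)
qed

definition lipschitz_units :: "quat set" where
  "lipschitz_units = {Quat 1 0 0 0, Quat (-1) 0 0 0, Quat 0 1 0 0, Quat 0 (-1) 0 0,
    Quat 0 0 1 0, Quat 0 0 (-1) 0, Quat 0 0 0 1, Quat 0 0 0 (-1)}"

lemma integral_quat_in_lipschitz_units:
  "Quat (of_int a) (of_int b) (of_int c) (of_int d) \<in> lipschitz_units" if "a\<^sup>2 + b\<^sup>2 + c\<^sup>2 + d\<^sup>2 = 1" for a b c d :: int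
  using sum_four_squares_eq_1[OF that] unfolding lipschitz_units_def
  by (elim insertE emptyE) simp_all

text \<open>
  If the coordinates are halves of odd integers, each has square at least \<open>1/4\<close>, so norm 1 forces equality in
  all four.
\<close>

lemma hurwitz_units:
  assumes u: "u \<in> hurwitz" and n: "quat_norm u = 1"
  shows "u \<in> lipschitz_units \<or>
    (\<exists>a b c d. u = Quat a b c d \<and> a \<in> {1/2, -1/2} \<and> b \<in> {1/2, -1/2} \<and> c \<in> {1/2, -1/2} \<and> d \<in> {1/2, -1/2})"
proof -
  obtain a b c d where x: "u = Quat a b c d"
    and *: "(a \<in> \<int> \<and> b \<in> \<int> \<and> c \<in> \<int> \<and> d \<in> \<int>) \<or>
      (a - 1/2 \<in> \<int> \<and> b - 1/2 \<in> \<int> \<and> c - 1/2 \<in> \<int> \<and> d - 1/2 \<in> \<int>)"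
    using u unfolding hurwitz_def by auto
  have n: "a\<^sup>2 + b\<^sup>2 + c\<^sup>2 + d\<^sup>2 = 1" using n by (simp add: x quat_norm_def)
  from * show ?thesis
  proof
    assume "a \<in> \<int> \<and> b \<in> \<int> \<and> c \<in> \<int> \<and> d \<in> \<int>"
    then obtain a' b' c' d' :: int where i: "a = a'" "b = b'" "c = c'" "d = d'"
      by (auto elim!: Ints_cases)
    then have "a'\<^sup>2 + b'\<^sup>2 + c'\<^sup>2 + d'\<^sup>2 = 1" using n by (metis (mono_tags) of_int_add of_int_eq_1_iff of_int_power)
    then show ?thesis using integral_quat_in_lipschitz_units x i by blast
  next
    assume half: "a - 1/2 \<in> \<int> \<and> b - 1/2 \<in> \<int> \<and> c - 1/2 \<in> \<int> \<and> d - 1/2 \<in> \<int>"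
    have ge: "1/4 \<le> t\<^sup>2" if t: "t - 1/2 \<in> \<int>" for t :: real
    proof -
      obtain k :: int where k: "t - 1/2 = k" using t by (auto elim: Ints_cases)
      have "0 \<le> k * (k + 1)" by (cases "k \<ge> 0") (auto simp: mult_nonpos_nonpos)
      then have "0 \<le> real_of_int k * (real_of_int k + 1)" by (metis of_int_0_le_iff of_int_1 of_int_add of_int_mult)
      moreover have t: "t = k + 1/2" using k by simp
      ultimately show ?thesis unfolding t by (simp add: power2_eq_square field_simps)
    qed
    have eq: "t \<in> {1/2, -1/2}" if "t\<^sup>2 = 1/4" for t :: real
      using that power2_eq_iff[of t "1/2"] by (simp add: power_divide)
    have "a\<^sup>2 = 1/4" "b\<^sup>2 = 1/4" "c\<^sup>2 = 1/4" "d\<^sup>2 = 1/4"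
      using half n ge[of a] ge[of b] ge[of c] ge[of d] by linarith+
    then show ?thesis using eq x by blast
  qed
qed

section \<open>The commutator ideal\<close>

text \<open>
  This lattice is the two-sided ideal generated by \<open>1 + i\<close>.
\<close>

definition even_quats :: "quat set" where
  "even_quats = {Quat (of_int a) (of_int b) (of_int c) (of_int d) | a b c d :: int. even (a + b + c + d)}"

text \<open>
  Writing the first coordinate through half the coordinate sum \<open>n\<close> makes the parity condition
  explicit, which turns the closure properties below into polynomial identities.
\<close>

lemma even_quatsI:
  fixes b c d n :: int
  assumes "x = Quat (2 * of_int n - of_int b - of_int c - of_int d) (of_int b) (of_int c) (of_int d)"
  shows "x \<in> even_quats"
proof -
  have "x = Quat (of_int (2 * n - b - c - d)) b c d" "even ((2 * n - b - c - d) + b + c + d)"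
    using assms by simp_all
  then show ?thesis unfolding even_quats_def by blast
qed

lemma even_quats_obtain:
  assumes "x \<in> even_quats"
  obtains b c d n :: int where "x = Quat (2 * n - b - c - d) b c d"
proof -
  obtain a b c d :: int where x: "x = Quat a b c d" and "even (a + b + c + d)"
    using assms unfolding even_quats_def by blast
  then obtain n where "a + b + c + d = 2 * n" by (elim evenE)
  then have "real_of_int (a + b + c + d) = real_of_int (2 * n)" by (rule arg_cong)
  then have "x = Quat (2 * n - b - c - d) b c d" by (simp add: x)
  then show ?thesis by (rule that)
qed

lemma even_quats_add: assumes "x \<in> even_quats" "y \<in> even_quats" shows "x + y \<in> even_quats"
proof -
  obtain b c d n :: int where "x = Quat (2 * n - b - c - d) b c d"
    using assms(1) by (rule even_quats_obtain)
  moreover obtain b' c' d' n' :: int where "y = Quat (2 * n' - b' - c' - d') b' c' d'"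
    using assms(2) by (rule even_quats_obtain)
  ultimately have "x + y = Quat (2 * of_int (n + n') - of_int (b + b') - of_int (c + c') - of_int (d + d'))
    (of_int (b + b')) (of_int (c + c')) (of_int (d + d'))" by (simp add: quat_eq_iff)
  then show ?thesis by (rule even_quatsI)
qed

lemma even_quats_uminus: assumes "x \<in> even_quats" shows "- x \<in> even_quats"
proof -
  obtain b c d n :: int where "x = Quat (2 * n - b - c - d) b c d"
    using assms by (rule even_quats_obtain)
  then have "- x = Quat (2 * of_int (- n) - of_int (- b) - of_int (- c) - of_int (- d))
    (of_int (- b)) (of_int (- c)) (of_int (- d))" by (simp add: quat_eq_iff)
  then show ?thesis by (rule even_quatsI)
qed

lemma even_quats_mult:
  assumes "x \<in> even_quats" "y \<in> hurwitz"
  shows "x * y \<in> even_quats" "y * x \<in> even_quats"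
proof -
  obtain b c d n :: int where x: "x = Quat (2 * n - b - c - d) b c d"
    using assms(1) by (rule even_quats_obtain)
  obtain p q r s :: int where y: "y = Quat (p/2) (p/2 + q) (p/2 + r) (p/2 + s)"
    using assms(2) by (rule hurwitz_obtain)
  have "x * y = Quat (2 * of_int N - of_int B - of_int C - of_int D) (of_int B) (of_int C) (of_int D)"
    if "B = n * p + 2 * n * q - b * q - c * q - d * q - d * p + c * s - d * r"
      "C = n * p + 2 * n * r - b * r - c * r - d * r - b * p - b * s + d * q"
      "D = n * p + 2 * n * s - b * s - c * s - d * s - c * p + b * r - c * q"
      "N = (2 * n * p + n * q + n * r + n * s) - (b * p + c * p + d * p) - b * q - b * s - c * q - c * r - d * r - d * s"
    for B C D N
    unfolding x y that by (simp add: quat_eq_iff quat_times_sel field_simps)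
  from even_quatsI[OF this[OF HOL.refl HOL.refl HOL.refl HOL.refl]] show "x * y \<in> even_quats" .
  have "y * x = Quat (2 * of_int N - of_int B - of_int C - of_int D) (of_int B) (of_int C) (of_int D)"
    if "B = n * p + 2 * n * q - b * q - c * q - d * q - c * p - c * s + d * r"
      "C = n * p + 2 * n * r - b * r - c * r - d * r - d * p + b * s - d * q"
      "D = n * p + 2 * n * s - b * s - c * s - d * s - b * p - b * r + c * q"
      "N = (2 * n * p + n * q + n * r + n * s) - (b * p + c * p + d * p) - b * q - b * r - c * r - c * s - d * s - d * q"
    for B C D N
    unfolding x y that by (simp add: quat_eq_iff quat_times_sel field_simps)
  from even_quatsI[OF this[OF HOL.refl HOL.refl HOL.refl HOL.refl]] show "y * x \<in> even_quats" .
qed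

lemma commutator_even: assumes "x \<in> hurwitz" "y \<in> hurwitz" shows "x * y - y * x \<in> even_quats"
proof -
  obtain p q r s :: int where x: "x = Quat (p/2) (p/2 + q) (p/2 + r) (p/2 + s)"
    using assms(1) by (rule hurwitz_obtain)
  obtain p' q' r' s' :: int where y: "y = Quat (p'/2) (p'/2 + q') (p'/2 + r') (p'/2 + s')"
    using assms(2) by (rule hurwitz_obtain)
  have "x * y - y * x = Quat (2 * of_int N - of_int B - of_int C - of_int D) (of_int B) (of_int C) (of_int D)"
    if "B = p * s' + r * p' + 2 * r * s' - p * r' - s * p' - 2 * s * r'"
      "C = p * q' + s * p' + 2 * s * q' - p * s' - q * p' - 2 * q * s'"
      "D = p * r' + q * p' + 2 * q * r' - p * q' - r * p' - 2 * r * q'"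
      "N = r * s' - s * r' + s * q' - q * s' + q * r' - r * q'"
    for B C D N
    unfolding x y that by (simp add: quat_eq_iff quat_times_sel field_simps)
  from even_quatsI[OF this[OF HOL.refl HOL.refl HOL.refl HOL.refl]] show ?thesis .
qed

text \<open>
  The inclusion from right to left rests on a single commutator, \<open>h i - i h = j - k\<close> with
  \<open>h = (1 + i + j + k)/2\<close>: dividing a quaternion with even coordinate sum by \<open>j - k\<close> gives a Hurwitz integer.
\<close>

lemma hurwitz_commutator_ideal_eq: "hurwitz_commutator_ideal = even_quats"
proof
  interpret R: ring hurwitz_ring by (rule ring_hurwitz_ring)
  let ?S = "{a * b - b * a | a b. a \<in> hurwitz \<and> b \<in> hurwitz}"
  have sub: "even_quats \<subseteq> hurwitz"
  proof
    fix x assume "x \<in> even_quats"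
    then obtain a b c d :: int where "x = Quat a b c d" unfolding even_quats_def by blast
    then show "x \<in> hurwitz" using hurwitz_integral by blast
  qed
  have inv: "inv\<^bsub>add_monoid hurwitz_ring\<^esub> x = - x" if "x \<in> hurwitz" for x
    using R.minus_equality[of "- x" x] that unfolding a_inv_def by (simp add: hurwitz_ring_def)
  have "subgroup even_quats (add_monoid hurwitz_ring)"
  proof (rule subgroup.intro)
    show "even_quats \<subseteq> carrier (add_monoid hurwitz_ring)" using sub by (simp add: hurwitz_ring_def)
    show "x \<otimes>\<^bsub>add_monoid hurwitz_ring\<^esub> y \<in> even_quats" if "x \<in> even_quats" "y \<in> even_quats" for x y
      using even_quats_add[OF that] by (simp add: hurwitz_ring_def)
    have "\<one>\<^bsub>add_monoid hurwitz_ring\<^esub> = Quat (2 * of_int 0 - of_int 0 - of_int 0 - of_int 0) (of_int 0) (of_int 0) (of_int 0)"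
      by (simp add: hurwitz_ring_def quat_defs)
    then show "\<one>\<^bsub>add_monoid hurwitz_ring\<^esub> \<in> even_quats" by (rule even_quatsI)
    show "inv\<^bsub>add_monoid hurwitz_ring\<^esub> x \<in> even_quats" if "x \<in> even_quats" for x
      using inv[of x] that sub even_quats_uminus by auto
  qed
  then have "ideal even_quats hurwitz_ring"
    by (intro idealI ring_hurwitz_ring) (auto simp: hurwitz_ring_def intro: even_quats_mult)
  moreover have "?S \<subseteq> even_quats" using commutator_even by blast
  ultimately show "hurwitz_commutator_ideal \<subseteq> even_quats"
    unfolding hurwitz_commutator_ideal_def by (rule R.genideal_minimal)
  show "even_quats \<subseteq> hurwitz_commutator_ideal"
  proof
    fix x assume "x \<in> even_quats"
    then obtain b c d n :: int where x: "x = Quat (2 * n - b - c - d) b c d"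
      by (rule even_quats_obtain)
    have S: "?S \<subseteq> carrier hurwitz_ring" by (auto simp: hurwitz_ring_def)
    interpret C: ideal hurwitz_commutator_ideal hurwitz_ring
      unfolding hurwitz_commutator_ideal_def by (rule R.genideal_ideal[OF S])
    define h where "h = Quat (1/2) (1/2) (1/2) (1/2)"
    have h: "h \<in> hurwitz" using hurwitz_half_integral[of 0 0 0 0] by (simp add: h_def)
    have i: "Quat 0 1 0 0 \<in> hurwitz" using hurwitz_integral[of 0 1 0 0] by simp
    have "h * Quat 0 1 0 0 - Quat 0 1 0 0 * h \<in> ?S" using h i by blast
    moreover have "h * Quat 0 1 0 0 - Quat 0 1 0 0 * h = Quat 0 0 1 (-1)"
      by (simp add: h_def quat_defs)
    ultimately have g: "Quat 0 0 1 (-1) \<in> hurwitz_commutator_ideal"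
      using R.genideal_self[OF S] unfolding hurwitz_commutator_ideal_def by auto
    have "x = Quat 0 0 1 (-1) * Quat ((c-d)/2) ((c-d)/2 + of_int (-c)) ((c-d)/2 + of_int (b - n + d)) ((c-d)/2 + of_int (n - c))"
      by (simp add: x quat_defs field_simps)
    moreover have "Quat ((c-d)/2) ((c-d)/2 + of_int (-c)) ((c-d)/2 + of_int (b - n + d)) ((c-d)/2 + of_int (n - c)) \<in> hurwitz"
      unfolding hurwitz_iff by (metis of_int_diff)
    ultimately show "x \<in> hurwitz_commutator_ideal"
      using C.I_r_closed[OF g] by (simp add: hurwitz_ring_def)
  qed
qed

text \<open>
  The kernel of the map from the 24 Hurwitz units onto the nonzero elements of the quotient field
  with 4 elements consists of the 8 integral units.
\<close>

lemma unit_eq_1_mod_commutators: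
  assumes "u - 1 \<in> even_quats" "quat_norm u = 1"
  shows "u \<in> lipschitz_units"
proof -
  obtain a b c d :: int where "u - 1 = Quat a b c d"
    using assms(1) unfolding even_quats_def by blast
  then have u: "u = Quat (of_int (a + 1)) (of_int b) (of_int c) (of_int d)"
    by (simp add: quat_eq_iff)
  have "(a + 1)\<^sup>2 + b\<^sup>2 + c\<^sup>2 + d\<^sup>2 = 1"
    using assms(2) unfolding u quat_norm_def quat.sel by (metis (mono_tags) of_int_add of_int_eq_1_iff of_int_power)
  then show ?thesis unfolding u by (rule integral_quat_in_lipschitz_units)
qed

lemma lipschitz_unit_eq_1_mod_commutators: "u \<in> lipschitz_units \<Longrightarrow> u - 1 \<in> even_quats"
proof -
  have *: "Quat (of_int a) (of_int b) (of_int c) (of_int d) \<in> even_quats" if "even (a + b + c + d)" for a b c d :: int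
    using that unfolding even_quats_def by blast
  note ** = *[of 0 0 0 0] *[of "-2" 0 0 0] *[of "-1" 1 0 0] *[of "-1" "-1" 0 0]
    *[of "-1" 0 1 0] *[of "-1" 0 "-1" 0] *[of "-1" 0 0 1] *[of "-1" 0 0 "-1"]
  show "u \<in> lipschitz_units \<Longrightarrow> u - 1 \<in> even_quats"
    using ** by (auto simp: lipschitz_units_def quat_defs)
qed

section \<open>Integral matrices of determinant one modulo commutators\<close>

text \<open>
  The preimage in \<open>SL\<^sub>2\<close> of the group of the theorem.
\<close>

definition SL2_0_hurwitz :: "(quat^2^2) set" where
  "SL2_0_hurwitz = {S \<in> carrier SL2_quat. (\<forall>i j. S $ i $ j \<in> hurwitz) \<and>
     (S $ 1 $ 1 * S $ 2 $ 2 - S $ 1 $ 2 * S $ 2 $ 1) - 1 \<in> hurwitz_commutator_ideal}"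

lemma mat2_in_SL2_0_hurwitz:
  "mat2 a b c d \<in> SL2_0_hurwitz \<longleftrightarrow>
    a \<in> hurwitz \<and> b \<in> hurwitz \<and> c \<in> hurwitz \<and> d \<in> hurwitz \<and>
    (quat_norm a + quat_norm b) * (quat_norm c + quat_norm d) - quat_norm (a * quat_cnj c + b * quat_cnj d) = 1 \<and>
    a * d - b * c - 1 \<in> even_quats"
  by (auto simp: SL2_0_hurwitz_def SL2_quat_def hermitian_det_mult_adjoint[simplified] forall_2 hurwitz_commutator_ideal_eq)

lemma zero_in_even_quats: "0 \<in> even_quats"
  by (rule even_quatsI[of _ 0 0 0 0]) (simp add: quat_defs)

lemma quat_norm_add: "quat_norm (x + y) = quat_norm x + quat_norm y + 2 * quat_re (x * quat_cnj y)"
  by (simp add: quat_norm_def quat_times_sel power2_eq_square algebra_simps)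

lemma quat_norm_of_real [simp]: "quat_norm (quat_of_real r) = r\<^sup>2"
  by (simp add: quat_norm_def)

abbreviation translation :: "quat \<Rightarrow> quat^2^2" where
  "translation x \<equiv> mat2 1 x 0 1"

abbreviation inversion :: "quat^2^2" where
  "inversion \<equiv> mat2 0 1 (- 1) 0"

abbreviation diagonal :: "quat \<Rightarrow> quat \<Rightarrow> quat^2^2" where
  "diagonal u v \<equiv> mat2 u 0 0 v"

text \<open>
  Both the passage from words to matrices, which prepends one letter at a time, and the Euclidean
  algorithm proceed by left multiplication with translations, the inversion and diagonal matrices.
\<close>

lemma translation_mult:
  assumes x: "x \<in> hurwitz" and S: "S \<in> SL2_0_hurwitz"
  shows "translation x ** S \<in> SL2_0_hurwitz"
proof (cases S)
  case (1 a b c d)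
  note S = S[unfolded 1 mat2_in_SL2_0_hurwitz]
  have eq: "translation x ** S = mat2 (a + x * c) (b + x * d) c d" unfolding 1 by simp
  \<comment> \<open>Adding \<open>x\<close> times the second row to the first leaves the Gram determinant of the rows unchanged;
    \<open>q\<close> is the inner product of the rows and \<open>r\<close> the squared length of the second.\<close>
  define q r where "q = a * quat_cnj c + b * quat_cnj d" and "r = quat_norm c + quat_norm d"
  have n: "quat_norm (a + x * c) + quat_norm (b + x * d) =
    quat_norm a + quat_norm b + quat_norm x * r + 2 * quat_re (q * quat_cnj x)"
    unfolding q_def r_def by (simp add: quat_norm_add quat_norm_mult algebra_simps)
  have q: "(a + x * c) * quat_cnj c + (b + x * d) * quat_cnj d = q + x * quat_of_real r"
    unfolding q_def r_def by (simp add: algebra_simps quat_mult_cnj(1))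
  have "quat_norm (q + x * quat_of_real r) =
    quat_norm q + quat_norm x * r\<^sup>2 + 2 * quat_re (q * quat_cnj x) * r"
    unfolding quat_norm_add[of q] quat_norm_mult quat_norm_of_real
    by (simp add: quat_times_sel algebra_simps)
  then have "(quat_norm (a + x * c) + quat_norm (b + x * d)) * r - quat_norm (q + x * quat_of_real r) =
    (quat_norm a + quat_norm b) * r - quat_norm q"
    unfolding n by (simp add: power2_eq_square algebra_simps)
  then have D: "(quat_norm (a + x * c) + quat_norm (b + x * d)) * (quat_norm c + quat_norm d)
    - quat_norm ((a + x * c) * quat_cnj c + (b + x * d) * quat_cnj d) = 1"
    unfolding q using S by (simp add: q_def r_def)
  have "(a + x * c) * d - (b + x * d) * c - 1 = (a * d - b * c - 1) + x * (c * d - d * c)"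
    by (simp add: algebra_simps)
  then have E: "(a + x * c) * d - (b + x * d) * c - 1 \<in> even_quats"
    using S x by (simp only: even_quats_add even_quats_mult commutator_even)
  show ?thesis unfolding eq mat2_in_SL2_0_hurwitz using S D E x by (blast intro: hurwitz_closed)
qed

lemma inversion_mult:
  assumes S: "S \<in> SL2_0_hurwitz"
  shows "inversion ** S \<in> SL2_0_hurwitz"
proof (cases S)
  case (1 a b c d)
  note S = S[unfolded 1 mat2_in_SL2_0_hurwitz]
  have eq: "inversion ** S = mat2 c d (- a) (- b)" unfolding 1 by simp
  have "c * quat_cnj (- a) + d * quat_cnj (- b) = - quat_cnj (a * quat_cnj c + b * quat_cnj d)" by simp
  then have "quat_norm (c * quat_cnj (- a) + d * quat_cnj (- b)) = quat_norm (a * quat_cnj c + b * quat_cnj d)"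
    by (simp only: quat_norm_simps)
  then have D: "(quat_norm c + quat_norm d) * (quat_norm (- a) + quat_norm (- b))
    - quat_norm (c * quat_cnj (- a) + d * quat_cnj (- b)) = 1"
    using S by (simp only: quat_norm_simps mult.commute)
  have "c * (- b) - d * (- a) - 1 = (a * d - b * c - 1) + ((d * a - a * d) + (b * c - c * b))" by simp
  then have E: "c * (- b) - d * (- a) - 1 \<in> even_quats"
    using S by (simp only: even_quats_add commutator_even)
  show ?thesis unfolding eq mat2_in_SL2_0_hurwitz using S D E by (blast intro: hurwitz_uminus)
qed

lemma diagonal_mult:
  assumes uv: "u \<in> hurwitz" "v \<in> hurwitz" "quat_norm u = 1" "quat_norm v = 1" "u * v - 1 \<in> even_quats"
    and S: "S \<in> SL2_0_hurwitz"
  shows "diagonal u v ** S \<in> SL2_0_hurwitz"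
proof (cases S)
  case (1 a b c d)
  note S = S[unfolded 1 mat2_in_SL2_0_hurwitz]
  have eq: "diagonal u v ** S = mat2 (u * a) (u * b) (v * c) (v * d)" unfolding 1 by simp
  have "u * a * quat_cnj (v * c) + u * b * quat_cnj (v * d) =
    u * (a * quat_cnj c + b * quat_cnj d) * quat_cnj v" by (simp add: algebra_simps)
  then have "quat_norm (u * a * quat_cnj (v * c) + u * b * quat_cnj (v * d)) =
    quat_norm (a * quat_cnj c + b * quat_cnj d)"
    using uv by (simp only: quat_norm_mult quat_norm_simps mult_1_left mult_1_right)
  then have D: "(quat_norm (u * a) + quat_norm (u * b)) * (quat_norm (v * c) + quat_norm (v * d))
    - quat_norm (u * a * quat_cnj (v * c) + u * b * quat_cnj (v * d)) = 1"
    using S uv by (simp only: quat_norm_mult mult_1_left)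
  have "u * a * (v * d) - u * b * (v * c) - 1 =
    u * v * (a * d - b * c - 1) + (u * v - 1) + u * ((a * v - v * a) * d) + u * ((v * b - b * v) * c)"
    by (simp add: algebra_simps)
  then have E: "u * a * (v * d) - u * b * (v * c) - 1 \<in> even_quats"
    using S uv by (simp only: even_quats_add even_quats_mult commutator_even hurwitz_closed)
  show ?thesis unfolding eq mat2_in_SL2_0_hurwitz using S D E uv by (blast intro: hurwitz_closed)
qed

section \<open>Matrices realizing Weyl group elements\<close>

definition realizes :: "quat^2^2 \<Rightarrow> int list \<Rightarrow> bool" where
  "realizes S w \<longleftrightarrow> (\<forall>x. conjugate S x = hermitian_matrix (B4pp_action w x))"

lemma conjugate_mult: "conjugate (S ** T) x = S ** conjugate T x ** quat_adjoint S"
  by (simp add: conjugate_def quat_adjoint_mult matrix_mul_assoc)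

lemma realizes_mult: "realizes S w \<Longrightarrow> realizes T v \<Longrightarrow> realizes (S ** T) (w @ v)"
  unfolding realizes_def conjugate_mult by (metis conjugate_def foldr_append comp_apply)

lemma realizes_uminus [simp]: "realizes (- S) w \<longleftrightarrow> realizes S w"
  by (simp add: realizes_def conjugate_def matrix_minus_mult)

lemma conjugate_mat_1 [simp]: "conjugate (mat 1) x = hermitian_matrix x"
  by (cases x) (simp add: conjugate_def mat_1_eq_mat2)

lemma realizes_Nil: "realizes (mat 1) []"
  by (simp add: realizes_def)

lemma realizes_cong: "B4pp_action w = B4pp_action v \<Longrightarrow> realizes S w \<Longrightarrow> realizes S v"
  by (simp add: realizes_def)

lemma action_rev:
  assumes "w \<in> lists B4pp_nodes"
  shows "B4pp_action w (B4pp_action (rev w) x) = x" "B4pp_action (rev w) (B4pp_action w x) = x"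
proof -
  have "rev w \<in> lists B4pp_nodes" using assms by auto
  from coxeter_equiv_rev_append[OF assms] coxeter_equiv_rev_append[OF this]
  show "B4pp_action w (B4pp_action (rev w) x) = x" "B4pp_action (rev w) (B4pp_action w x) = x"
    using B4pp.word_action_cong by (metis foldr.simps(1) foldr_append comp_apply id_apply rev_rev_ident)+
qed

lemma realizes_inverse:
  assumes "realizes S w" "T ** S = mat 1" "w \<in> lists B4pp_nodes"
  shows "realizes T (rev w)"
  unfolding realizes_def
proof
  fix x
  have "conjugate S (B4pp_action (rev w) x) = hermitian_matrix x"
    using assms(1) action_rev(1)[OF assms(3)] unfolding realizes_def by metis
  then have "conjugate T x = conjugate (T ** S) (B4pp_action (rev w) x)"
    unfolding conjugate_mult by (simp only: conjugate_def[of T])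
  then show "conjugate T x = hermitian_matrix (B4pp_action (rev w) x)" by (simp add: assms(2))
qed

text \<open>
  Reflection in a quaternion \<open>u\<close> of norm 1 is \<open>q \<mapsto> - u (quat_cnj q) u\<close>, and the
  reflection of the node \<open>-1\<close> exchanges the diagonal entries. The two commute, which gives both orders at once.
\<close>

lemma realizes_reflection_pair:
  assumes "\<And>p q r. B4pp_action w (p, q, r) = (p, - (u * quat_cnj q * u), r)" "quat_norm u = 1"
  shows "realizes (mat2 0 u (- quat_cnj u) 0) (-1 # w)" "realizes (mat2 0 u (- quat_cnj u) 0) (w @ [-1])"
proof -
  have 1: "u * (quat_of_real r * quat_cnj u) = quat_of_real r" "quat_cnj u * (quat_of_real r * u) = quat_of_real r" for r
    using assms(2) quat_mult_cnj[of u] quat_of_real_commute[of r] by (metis mult.assoc mult.left_neutral mult.right_neutral quat_of_real_simps(2))+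
  have 2: "B4pp_reflection (-1) (p, q, r) = (r, q, p)" for p q r
    by (cases q) (simp add: B4pp_reflection_simps)
  show "realizes (mat2 0 u (- quat_cnj u) 0) (-1 # w)" "realizes (mat2 0 u (- quat_cnj u) 0) (w @ [-1])"
    by (auto simp: realizes_def conjugate_def assms 1 2 mult.assoc)
qed

text \<open>
  The reflection of the node 0 is the translation by 1 composed with the reflection in the highest root
  of \<open>D\<^sub>4\<close>, the quaternion 1; and the product of the latter with the reflection of the node \<open>-1\<close> is the
  inversion.
\<close>

lemma realizes_affine_node:
  "realizes (inversion ** translation (- 1)) [-1, 0]" "realizes (translation 1 ** inversion) [0, -1]"
proof -
  have "conjugate (mat2 0 1 (-1) 1) x = hermitian_matrix (B4pp_action [-1, 0] x)"
    "conjugate (mat2 (-1) 1 (-1) 0) x = hermitian_matrix (B4pp_action [0, -1] x)" for x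
    by (cases x rule: hermitian_exhaust;
      simp add: conjugate_def B4pp_reflection_simps quat_eq_iff quat_times_sel)+
  then show "realizes (inversion ** translation (- 1)) [-1, 0]" "realizes (translation 1 ** inversion) [0, -1]"
    unfolding realizes_def by simp_all
qed

lemma root_reflections:
  "B4pp_action [1] (p, q, r) = (p, - (Quat (1/2) (-1/2) (-1/2) (-1/2) * quat_cnj q * Quat (1/2) (-1/2) (-1/2) (-1/2)), r)"
  "B4pp_action [2] (p, q, r) = (p, - (Quat 0 1 0 0 * quat_cnj q * Quat 0 1 0 0), r)"
  "B4pp_action [3] (p, q, r) = (p, - (Quat 0 0 1 0 * quat_cnj q * Quat 0 0 1 0), r)"
  "B4pp_action [4, 3, 4] (p, q, r) = (p, - (Quat 0 0 0 1 * quat_cnj q * Quat 0 0 0 1), r)"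
proof -
  obtain a b c d where q: "q = Quat a b c d" by (cases q)
  show "B4pp_action [1] (p, q, r) =
    (p, - (Quat (1/2) (-1/2) (-1/2) (-1/2) * quat_cnj q * Quat (1/2) (-1/2) (-1/2) (-1/2)), r)"
    unfolding q by (simp add: B4pp_reflection_simps quat_defs quat_cnj_def) argo
qed (cases q; simp add: B4pp_reflection_simps quat_defs quat_cnj_def)+

section \<open>Even Weyl group elements act by integral matrices\<close>

text \<open>
  A single reflection is not of the form \<open>X \<mapsto> S X S\<^sup>\<dagger>\<close>. The reflections \<open>-1\<close> and 4 serve as coset
  representatives: up to such a prefix, determined by the parities of the number of letters other
  than 4 (\<open>e\<close>) and of the number of letters 4 (\<open>f\<close>), every word is realized by a matrix.
\<close>

definition parity_word :: "bool \<Rightarrow> bool \<Rightarrow> int list" where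
  "parity_word e f = (if e then [-1] else []) @ (if f then [4] else [])"

text \<open>
  Moving the letter \<open>i\<close> past the prefix leaves a product of the reflection \<open>-1\<close> with one long-root
  reflection. Conjugation by reflection 4 fixes the reflections \<open>-1\<close>, 0, 1, 2 and turns the reflection in
  \<open>j\<close> into the one in \<open>k\<close>.
\<close>

lemma realizes_parity_step:
  assumes "i \<in> {-1, 0, 1, 2, 3}"
  shows "\<exists>M. (\<forall>S\<in>SL2_0_hurwitz. M ** S \<in> SL2_0_hurwitz) \<and>
    realizes M (parity_word (\<not> e) f @ [i] @ rev (parity_word e f))"
proof -
  have unit: "\<forall>S\<in>SL2_0_hurwitz. mat2 0 u (- quat_cnj u) 0 ** S \<in> SL2_0_hurwitz"
    if "u \<in> hurwitz" "quat_norm u = 1" for u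
  proof
    fix S assume "S \<in> SL2_0_hurwitz"
    then have "diagonal u (quat_cnj u) ** (inversion ** S) \<in> SL2_0_hurwitz"
      using that by (intro diagonal_mult inversion_mult) (auto simp: quat_mult_cnj zero_in_even_quats)
    then show "mat2 0 u (- quat_cnj u) 0 ** S \<in> SL2_0_hurwitz" by (simp add: matrix_mul_assoc)
  qed
  have two: ?thesis
    if u: "u \<in> hurwitz" "quat_norm u = 1" and w: "\<And>p q r. B4pp_action w (p, q, r) = (p, - (u * quat_cnj q * u), r)"
      and c: "\<And>x. B4pp_action (parity_word (\<not> e) f @ [i] @ rev (parity_word e f)) x =
        B4pp_action (if e then w @ [-1] else -1 # w) x" for u w
  proof (intro exI conjI)
    show "realizes (mat2 0 u (- quat_cnj u) 0) (parity_word (\<not> e) f @ [i] @ rev (parity_word e f))"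
      by (rule realizes_cong[OF ext[OF c[symmetric]]]) (use realizes_reflection_pair[OF w u(2)] in simp)
  qed (rule unit[OF u])
  have h: "Quat (1/2) (-1/2) (-1/2) (-1/2) \<in> hurwitz" "Quat 0 1 0 0 \<in> hurwitz" "Quat 0 0 1 0 \<in> hurwitz" "Quat 0 0 0 1 \<in> hurwitz"
    using hurwitz_half_integral[of 0 "-1" "-1" "-1"] hurwitz_integral[of 0 1 0 0] hurwitz_integral[of 0 0 1 0]
      hurwitz_integral[of 0 0 0 1] by simp_all
  consider "i = -1" | "i = 0" | "i = 1" | "i = 2" | "i = 3" using assms by blast
  then show ?thesis
  proof cases
    case 1
    have "B4pp_action [] x = B4pp_action (parity_word (\<not> e) f @ [i] @ rev (parity_word e f)) x" for x
      by (cases x rule: hermitian_exhaust) (simp add: 1 parity_word_def B4pp_reflection_simps)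
    then show ?thesis using realizes_cong[OF ext realizes_Nil] by (intro exI[of _ "mat 1"]) simp
  next
    case 2
    have c: "B4pp_action (if e then [0, -1] else [-1, 0]) x =
      B4pp_action (parity_word (\<not> e) f @ [i] @ rev (parity_word e f)) x" for x
      by (cases x rule: hermitian_exhaust) (simp add: 2 parity_word_def B4pp_reflection_simps)
    have "realizes (if e then translation 1 ** inversion else inversion ** translation (- 1))
        (parity_word (\<not> e) f @ [i] @ rev (parity_word e f))"
      by (rule realizes_cong[OF ext[OF c]]) (use realizes_affine_node in \<open>simp split: if_split\<close>)
    moreover have "inversion ** translation (- 1) ** S \<in> SL2_0_hurwitz" "translation 1 ** inversion ** S \<in> SL2_0_hurwitz"
      if "S \<in> SL2_0_hurwitz" for S
      using that by (simp_all only: matrix_mul_assoc[symmetric] translation_mult inversion_mult hurwitz_closed hurwitz_uminus)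
    ultimately show ?thesis
      by (intro exI[of _ "if e then translation 1 ** inversion else inversion ** translation (- 1)"]) simp
  next
    case 3
    show ?thesis
    proof (rule two[OF h(1) _ root_reflections(1)])
      show "B4pp_action (parity_word (\<not> e) f @ [i] @ rev (parity_word e f)) x =
        B4pp_action (if e then [1] @ [-1] else -1 # [1]) x" for x
        by (cases x rule: hermitian_exhaust) (simp add: 3 parity_word_def B4pp_reflection_simps field_simps)
    qed (simp add: quat_norm_def power2_eq_square)
  next
    case 4
    show ?thesis
    proof (rule two[OF h(2) _ root_reflections(2)])
      show "B4pp_action (parity_word (\<not> e) f @ [i] @ rev (parity_word e f)) x =
        B4pp_action (if e then [2] @ [-1] else -1 # [2]) x" for x
        by (cases x rule: hermitian_exhaust) (simp add: 4 parity_word_def B4pp_reflection_simps)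
    qed (simp add: quat_norm_def)
  next
    case 5
    show ?thesis
    proof (cases f)
      case True
      show ?thesis
      proof (rule two[OF h(4) _ root_reflections(4)])
        show "B4pp_action (parity_word (\<not> e) f @ [i] @ rev (parity_word e f)) x =
          B4pp_action (if e then [4, 3, 4] @ [-1] else -1 # [4, 3, 4]) x" for x
          by (cases x rule: hermitian_exhaust) (simp add: 5 True parity_word_def B4pp_reflection_simps)
      qed (simp add: quat_norm_def)
    next
      case False
      show ?thesis
      proof (rule two[OF h(3) _ root_reflections(3)])
        show "B4pp_action (parity_word (\<not> e) f @ [i] @ rev (parity_word e f)) x =
          B4pp_action (if e then [3] @ [-1] else -1 # [3]) x" for x
          by (cases x rule: hermitian_exhaust) (simp add: 5 False parity_word_def B4pp_reflection_simps)
      qed (simp add: quat_norm_def)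
    qed
  qed
qed

lemma mat_1_in_SL2_0_hurwitz: "mat 1 \<in> SL2_0_hurwitz"
  by (simp add: mat_1_eq_mat2 mat2_in_SL2_0_hurwitz zero_in_even_quats)

lemma word_realized_up_to_parity:
  assumes "w \<in> lists B4pp_nodes"
  shows "\<exists>S\<in>SL2_0_hurwitz. realizes S (parity_word (odd (length w + count_list w 4)) (odd (count_list w 4)) @ w)"
  using assms
proof (induction w)
  case Nil
  then show ?case using mat_1_in_SL2_0_hurwitz realizes_Nil by (auto simp: parity_word_def)
next
  case (Cons i w)
  define e f where "e = odd (length w + count_list w 4)" and "f = odd (count_list w 4)"
  obtain S where S: "S \<in> SL2_0_hurwitz" "realizes S (parity_word e f @ w)"
    using Cons by (auto simp: e_def f_def)
  show ?case
  proof (cases "i = 4")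
    case True
    have "B4pp_action (parity_word e f @ w) x = B4pp_action (parity_word e (\<not> f) @ i # w) x" for x
      using B4pp.refl_refl[of 4] by (simp add: parity_word_def True B4pp_nodes_eq)
    then have "realizes S (parity_word e (\<not> f) @ i # w)" using S(2) realizes_cong by blast
    then show ?thesis using S(1) True by (auto simp: e_def f_def)
  next
    case False
    then have "i \<in> {-1, 0, 1, 2, 3}" using Cons by (auto simp: B4pp_nodes_eq)
    then obtain M where M: "\<forall>S\<in>SL2_0_hurwitz. M ** S \<in> SL2_0_hurwitz"
        "realizes M (parity_word (\<not> e) f @ [i] @ rev (parity_word e f))"
      using realizes_parity_step by blast
    have "parity_word e f \<in> lists B4pp_nodes" by (simp add: parity_word_def B4pp_nodes_eq)
    from realizes_mult[OF M(2) S(2)] action_rev(2)[OF this]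
    have "realizes (M ** S) (parity_word (\<not> e) f @ i # w)"
      by (simp add: realizes_def)
    then show ?thesis using S(1) M(1) False by (auto simp: e_def f_def)
  qed
qed

text \<open>
  The words of even length with an even number of letters 4 represent \<open>W\<^sup>+(D\<^sub>4\<^sup>+\<^sup>+)\<close> inside
  \<open>W\<^sup>+(B\<^sub>4\<^sup>+\<^sup>+)\<close>: conjugation by the letter 4 turns the node 3 into the missing leg of the \<open>D\<^sub>4\<^sup>+\<^sup>+\<close> diagram.
\<close>

definition D4pp_even_words :: "int list set" where
  "D4pp_even_words = {w \<in> lists B4pp_nodes. even (length w) \<and> even (count_list w 4)}"

theorem even_word_realized:
  "w \<in> D4pp_even_words \<Longrightarrow> \<exists>S\<in>SL2_0_hurwitz. realizes S w"
  using word_realized_up_to_parity[of w] by (simp add: D4pp_even_words_def parity_word_def)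

lemma D4pp_even_words_append: "w \<in> D4pp_even_words \<Longrightarrow> v \<in> D4pp_even_words \<Longrightarrow> w @ v \<in> D4pp_even_words"
  by (auto simp: D4pp_even_words_def)

lemma D4pp_even_words_rev: "w \<in> D4pp_even_words \<Longrightarrow> rev w \<in> D4pp_even_words"
  by (auto simp: D4pp_even_words_def)

section \<open>Uniqueness of the realizing matrix\<close>

text \<open>
  A matrix \<open>S\<close> that realizes the inverse word is, up to sign, a two-sided inverse of \<open>R\<close> and of \<open>R'\<close>,
  because only \<open>\<plusminus>1\<close> acts trivially. Hence \<open>R S R'\<close> equals both \<open>\<plusminus>R\<close> and \<open>\<plusminus>R'\<close>. As \<open>R'\<close> may be any
  matrix, this applies to products before they are known to satisfy the congruence.
\<close>

lemma realizes_unique: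
  assumes w: "w \<in> D4pp_even_words" and R: "realizes R w" and R': "realizes R' w"
  shows "R' = R \<or> R' = - R"
proof -
  have wl: "w \<in> lists B4pp_nodes" using w by (simp add: D4pp_even_words_def)
  obtain S where S: "realizes S (rev w)"
    using even_word_realized[OF D4pp_even_words_rev[OF w]] by blast
  have *: "T = mat 1 \<or> T = - mat 1" if "realizes T (rev w @ w) \<or> realizes T (w @ rev w)" for T
    using that action_rev[OF wl] by (intro trivial_conjugation) (auto simp: realizes_def)
  have "S ** R' = mat 1 \<or> S ** R' = - mat 1" using *[of "S ** R'"] realizes_mult[OF S R'] by blast
  then have "R ** S ** R' = R \<or> R ** S ** R' = - R"
    by (auto simp: matrix_mul_assoc[symmetric] matrix_minus_mult)
  moreover have "R ** S = mat 1 \<or> R ** S = - mat 1" using *[of "R ** S"] realizes_mult[OF R S] by blast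
  then have "R ** S ** R' = R' \<or> R ** S ** R' = - R'"
    by (auto simp: matrix_minus_mult)
  ultimately show ?thesis by (metis minus_equation_iff)
qed

section \<open>Generation by translations, the inversion and diagonal matrices\<close>

definition realizable :: "quat^2^2 \<Rightarrow> bool" where
  "realizable S \<longleftrightarrow> (\<exists>w\<in>D4pp_even_words. realizes S w)"

lemma realizableI: "realizes S w \<Longrightarrow> w \<in> D4pp_even_words \<Longrightarrow> realizable S"
  by (auto simp: realizable_def)

lemma realizable_mult: "realizable S \<Longrightarrow> realizable T \<Longrightarrow> realizable (S ** T)"
  unfolding realizable_def by (blast intro: realizes_mult D4pp_even_words_append)

lemma realizable_uminus [simp]: "realizable (- S) \<longleftrightarrow> realizable S"
  by (simp add: realizable_def)

lemma realizable_inverse: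
  assumes "realizable S" "T ** S = mat 1"
  shows "realizable T"
proof -
  obtain w where w: "w \<in> D4pp_even_words" "realizes S w" using assms(1) by (auto simp: realizable_def)
  then have "realizes T (rev w)" using assms(2) by (intro realizes_inverse) (auto simp: D4pp_even_words_def)
  then show ?thesis using D4pp_even_words_rev[OF w(1)] by (rule realizableI)
qed

lemma realizable_mat_1: "realizable (mat 1)"
  by (rule realizableI[OF realizes_Nil]) (simp add: D4pp_even_words_def)

text \<open>
  The reflection in the highest root of \<open>D\<^sub>4\<close>, the quaternion 1. This root is the image of the
  root of the central node 1 under the product of the reflections 1, 2, 3 and 434, the last being the
  reflection in \<open>k\<close>.
\<close>

definition highest_root_word :: "int list" where
  "highest_root_word = [1, 2, 3, 4, 3, 4, 1, 4, 3, 4, 3, 2, 1]"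

lemma highest_root_word_action:
  "B4pp_action highest_root_word (p, q, r) = (p, - quat_cnj q, r)"
proof -
  obtain a b c d where q: "q = Quat a b c d" by (cases q)
  show ?thesis unfolding q
    by (simp add: highest_root_word_def B4pp_reflection_simps quat_defs quat_cnj_def) argo
qed

lemma highest_root_word_lists: "highest_root_word \<in> lists B4pp_nodes"
  "length highest_root_word = 13" "count_list highest_root_word 4 = 4"
  by (simp_all add: highest_root_word_def B4pp_nodes_def)

lemma realizable_inversion: "realizable inversion"
proof (rule realizableI)
  show "realizes inversion (-1 # highest_root_word)"
    using realizes_reflection_pair(1)[of highest_root_word 1] by (simp add: highest_root_word_action)
qed (use highest_root_word_lists in \<open>auto simp: D4pp_even_words_def B4pp_nodes_def\<close>)

lemma realizable_translation_1: "realizable (translation 1)"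
proof (rule realizableI)
  have "conjugate (translation 1) x = hermitian_matrix (B4pp_action (0 # highest_root_word) x)" for x
    by (cases x rule: hermitian_exhaust)
      (simp add: highest_root_word_action[simplified] conjugate_def B4pp_reflection_simps quat_cnj_def quat_of_real_def quat_defs)
  then show "realizes (translation 1) (0 # highest_root_word)" unfolding realizes_def by blast
qed (use highest_root_word_lists in \<open>auto simp: D4pp_even_words_def B4pp_nodes_def\<close>)

text \<open>
  Following the reflection in the quaternion 1, \<open>q \<mapsto> - quat_cnj q\<close>, by the reflection in \<open>u\<close> gives \<open>q \<mapsto> u q u\<close>.
\<close>

lemma realizable_if_reflection:
  assumes w: "\<And>p q r. B4pp_action w (p, q, r) = (p, - (u * quat_cnj q * u), r)"
    and u: "quat_norm u = 1"
    and l: "w \<in> lists B4pp_nodes" "odd (length w)" "even (count_list w 4)"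
  shows "realizable (diagonal u (quat_cnj u))"
proof (rule realizableI)
  have 1: "u * (quat_of_real r * quat_cnj u) = quat_of_real r" "quat_cnj u * (quat_of_real r * u) = quat_of_real r" for r
    using u quat_mult_cnj[of u] quat_of_real_commute[of r] by (metis mult.assoc mult.right_neutral quat_of_real_simps(2))+
  show "realizes (diagonal u (quat_cnj u)) (w @ highest_root_word)"
    by (auto simp: realizes_def conjugate_def highest_root_word_action w 1 mult.assoc)
  show "w @ highest_root_word \<in> D4pp_even_words"
    using l highest_root_word_lists by (simp add: D4pp_even_words_def)
qed

text \<open>
  Up to sign, every Hurwitz unit is one of \<open>1, i, j, k\<close> or arises from \<open>(1 - i - j - k)/2\<close>, the
  simple root of the node 1, by sign changes of the coordinates of \<open>i\<close>, \<open>j\<close>, \<open>k\<close>. These sign changes are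
  the reflections 2, 3 and 434, so the reflection in the unit is a conjugate of reflection 1.
\<close>

lemma realizable_hurwitz_unit:
  assumes u: "u \<in> hurwitz" "quat_norm u = 1"
  shows "realizable (diagonal u (quat_cnj u))"
proof -
  have "\<exists>w. (\<forall>p q r. B4pp_action w (p, q, r) = (p, - (u * quat_cnj q * u), r)) \<and>
    w \<in> lists B4pp_nodes \<and> odd (length w) \<and> even (count_list w 4)"
    using hurwitz_units[OF u]
  proof (elim disjE exE conjE)
    assume *: "u \<in> lipschitz_units"
    let ?w = "if u \<in> {Quat 1 0 0 0, Quat (-1) 0 0 0} then highest_root_word
      else if u \<in> {Quat 0 1 0 0, Quat 0 (-1) 0 0} then [2]
      else if u \<in> {Quat 0 0 1 0, Quat 0 0 (-1) 0} then [3] else [4, 3, 4]"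
    have "B4pp_action ?w (p, q, r) = (p, - (u * quat_cnj q * u), r)" for p q r
      using * unfolding lipschitz_units_def
      by (cases q; elim insertE emptyE)
        (simp_all add: highest_root_word_action B4pp_reflection_simps quat_defs quat_cnj_def)
    moreover have "?w \<in> lists B4pp_nodes \<and> odd (length ?w) \<and> even (count_list ?w 4)"
      using highest_root_word_lists by (simp add: B4pp_nodes_eq)
    ultimately show ?thesis by blast
  next
    fix a b c d
    assume eq: "u = Quat a b c d" and
      *: "a \<in> {1/2, -1/2}" "b \<in> {1/2, -1/2}" "c \<in> {1/2, -1/2}" "d \<in> {1/2, -1/2}"
    let ?v = "(if a * b > 0 then [2] else []) @ (if a * c > 0 then [3] else []) @
      (if a * d > 0 then [4, 3, 4] else []) :: int list"
    let ?w = "?v @ [1] @ rev ?v"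
    have "B4pp_action ?w (p, q, r) = (p, - (u * quat_cnj q * u), r)" for p q r
    proof -
      obtain x y z t where q: "q = Quat x y z t" by (cases q)
      show ?thesis using * unfolding q eq
        by (elim insertE emptyE; hypsubst; simp add: B4pp_reflection_simps quat_defs quat_cnj_def; argo)
    qed
    moreover have "?w \<in> lists B4pp_nodes \<and> odd (length ?w) \<and> even (count_list ?w 4)"
      by (simp add: B4pp_nodes_eq)
    ultimately show ?thesis by blast
  qed
  then show ?thesis using realizable_if_reflection u(2) by blast
qed

text \<open>
  The product of the diagonal matrices \<open>(u, quat_cnj u)\<close> for \<open>u = a\<close>, \<open>u = b\<close> and the inverse \<open>u\<close> of \<open>a b\<close> has first
  entry 1, while its second entry is a commutator.
\<close>

lemma realizable_commutator:
  assumes "a \<in> hurwitz" "quat_norm a = 1" "b \<in> hurwitz" "quat_norm b = 1"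
  shows "realizable (diagonal 1 (quat_cnj a * quat_cnj b * a * b))"
proof -
  have "realizable (diagonal a (quat_cnj a) ** diagonal b (quat_cnj b) **
    diagonal (quat_cnj b * quat_cnj a) (quat_cnj (quat_cnj b * quat_cnj a)))"
    using assms by (intro realizable_mult realizable_hurwitz_unit) (auto simp: quat_norm_mult)
  moreover have "a * b * (quat_cnj b * quat_cnj a) = quat_of_real (quat_norm (a * b))"
    using quat_mult_cnj(1)[of "a * b"] by simp
  ultimately show ?thesis using assms by (simp add: quat_norm_mult mult.assoc)
qed

text \<open>
  With \<open>h = (1 + i + j + k)/2\<close>, conjugation by \<open>h\<close> permutes \<open>i, j, k\<close> cyclically, so the commutators of \<open>h\<close> with
  them are \<open>-j, -k, -i\<close>, which generate all eight units.
\<close>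

lemma realizable_lipschitz_unit:
  assumes "q \<in> lipschitz_units"
  shows "realizable (diagonal 1 q)"
proof -
  let ?h = "Quat (1/2) (1/2) (1/2) (1/2)"
  have h: "?h \<in> hurwitz" "quat_norm ?h = 1"
    using hurwitz_half_integral[of 0 0 0 0] by (simp_all add: quat_norm_def power2_eq_square)
  have i: "Quat 0 1 0 0 \<in> hurwitz" "Quat 0 0 1 0 \<in> hurwitz" "Quat 0 0 0 1 \<in> hurwitz"
    using hurwitz_integral[of 0 1 0 0] hurwitz_integral[of 0 0 1 0] hurwitz_integral[of 0 0 0 1] by simp_all
  have m: "realizable (diagonal 1 (x * y))" if "realizable (diagonal 1 x)" "realizable (diagonal 1 y)" for x y
    using realizable_mult[OF that] by simp
  have j': "realizable (diagonal 1 (Quat 0 0 (-1) 0))"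
    and k': "realizable (diagonal 1 (Quat 0 0 0 (-1)))"
    and i': "realizable (diagonal 1 (Quat 0 (-1) 0 0))"
    using realizable_commutator[OF h i(1)] realizable_commutator[OF h i(2)] realizable_commutator[OF h i(3)]
    by (simp_all add: quat_norm_def quat_defs quat_cnj_def)
  have n: "realizable (diagonal 1 (Quat (-1) 0 0 0))"
    using m[OF i' i'] by (simp add: quat_defs)
  have "realizable (diagonal 1 1)" using realizable_mat_1 by (simp add: mat_1_eq_mat2)
  then show ?thesis
    using assms i' j' k' n m[OF n i'] m[OF n j'] m[OF n k'] unfolding lipschitz_units_def
    by (elim insertE emptyE) (simp_all add: quat_defs)
qed

text \<open>
  Splitting off \<open>(u, quat_cnj u)\<close> leaves \<open>(1, u v)\<close>, where \<open>u v\<close> is a unit congruent to 1.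
\<close>

lemma realizable_diagonal:
  assumes "u \<in> hurwitz" "v \<in> hurwitz" "quat_norm u = 1" "quat_norm v = 1" "u * v - 1 \<in> even_quats"
  shows "realizable (diagonal u v)"
proof -
  have "u * v \<in> lipschitz_units"
    using assms by (intro unit_eq_1_mod_commutators) (auto simp: quat_norm_mult)
  then have "realizable (diagonal u (quat_cnj u) ** diagonal 1 (u * v))"
    using assms by (intro realizable_mult realizable_hurwitz_unit realizable_lipschitz_unit)
  moreover have "quat_cnj u * (u * v) = v"
    using assms by (simp add: quat_mult_cnj flip: mult.assoc)
  ultimately show ?thesis by simp
qed

lemma realizable_translation_conj:
  assumes uv: "u \<in> hurwitz" "v \<in> hurwitz" "quat_norm u = 1" "quat_norm v = 1" "u * v - 1 \<in> even_quats"
    and x: "realizable (translation x)"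
  shows "realizable (translation (u * x * quat_cnj v))"
proof -
  have d: "realizable (diagonal u v)" using uv by (rule realizable_diagonal)
  have "realizable (diagonal (quat_cnj u) (quat_cnj v))"
    using uv by (intro realizable_inverse[OF d]) (simp add: quat_mult_cnj mat_1_eq_mat2)
  then have "realizable (diagonal u v ** translation x ** diagonal (quat_cnj u) (quat_cnj v))"
    using d x by (intro realizable_mult)
  then show ?thesis using uv by (simp add: quat_mult_cnj)
qed

lemma realizable_translation_add:
  "realizable (translation x) \<Longrightarrow> realizable (translation y) \<Longrightarrow> realizable (translation (x + y))"
  using realizable_mult[of "translation x" "translation y"] by (simp add: add.commute)

lemma realizable_translation_uminus:
  "realizable (translation x) \<Longrightarrow> realizable (translation (- x))"
  by (erule realizable_inverse) (simp add: mat_1_eq_mat2)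

lemma realizable_translation_of_int:
  assumes "realizable (translation x)"
  shows "realizable (translation (quat_of_real (of_int n) * x))"
proof -
  have nat: "realizable (translation (quat_of_real (of_nat k) * x))" for k
  proof (induction k)
    case 0
    then show ?case using realizable_mat_1 by (simp add: mat_1_eq_mat2)
  next
    case (Suc k)
    from realizable_translation_add[OF assms this] show ?case by (simp add: distrib_right)
  qed
  show ?thesis
  proof (cases n rule: int_cases2)
    case (nonneg k)
    then show ?thesis using nat[of k] by simp
  next
    case (nonpos k)
    moreover have "quat_of_real (- real k) * x = - (quat_of_real (real k) * x)"
      by (simp add: quat_eq_iff quat_times_sel)
    ultimately show ?thesis using realizable_translation_uminus[OF nat[of k]] by simp
  qed
qed

text \<open>
  Conjugating the translation by 1 with diagonal matrices gives the translations by \<open>i, j, k\<close>, and by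
  \<open>a\<^sup>2 = -(1 + i + j + k)/2\<close> for \<open>a = (-1 + i + j + k)/2\<close>. These generate the Hurwitz integers additively.
\<close>

lemma realizable_translation:
  assumes "x \<in> hurwitz"
  shows "realizable (translation x)"
proof -
  have "realizable (translation q)" if "q \<in> lipschitz_units" for q
  proof -
    have "q \<in> hurwitz" "quat_norm q = 1"
      using that hurwitz_integral[of 1 0 0 0] hurwitz_integral[of "-1" 0 0 0] hurwitz_integral[of 0 1 0 0]
        hurwitz_integral[of 0 "-1" 0 0] hurwitz_integral[of 0 0 1 0] hurwitz_integral[of 0 0 "-1" 0]
        hurwitz_integral[of 0 0 0 1] hurwitz_integral[of 0 0 0 "-1"]
      by (auto simp: lipschitz_units_def quat_norm_def)
    with that show ?thesis
      using realizable_translation_conj[of q 1, OF _ _ _ _ _ realizable_translation_1] lipschitz_unit_eq_1_mod_commutators[OF that]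
      by simp
  qed
  then have i: "realizable (translation (Quat 0 1 0 0))" "realizable (translation (Quat 0 0 1 0))"
      "realizable (translation (Quat 0 0 0 1))"
    by (simp_all add: lipschitz_units_def)
  let ?a = "Quat (-1/2) (1/2) (1/2) (1/2)"
  have "?a \<in> hurwitz" "quat_norm ?a = 1" "?a * quat_cnj ?a - 1 \<in> even_quats"
    using hurwitz_half_integral[of "-1" 0 0 0] zero_in_even_quats
    by (simp_all add: quat_norm_def power2_eq_square quat_mult_cnj)
  then have "realizable (translation (?a * 1 * ?a))"
    using realizable_translation_conj[of ?a "quat_cnj ?a", OF _ _ _ _ _ realizable_translation_1] by simp
  then have "realizable (translation (- (?a * 1 * ?a)))" by (rule realizable_translation_uminus)
  then have h: "realizable (translation (Quat (1/2) (1/2) (1/2) (1/2)))" by (simp add: quat_defs)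
  obtain p q r s :: int where x: "x = Quat (p/2) (p/2 + q) (p/2 + r) (p/2 + s)"
    using assms by (rule hurwitz_obtain)
  have "x = quat_of_real p * Quat (1/2) (1/2) (1/2) (1/2) + quat_of_real q * Quat 0 1 0 0 +
      quat_of_real r * Quat 0 0 1 0 + quat_of_real s * Quat 0 0 0 1"
    unfolding x by (simp add: quat_eq_iff quat_times_sel)
  then show ?thesis using h i
    by (simp only: realizable_translation_add realizable_translation_of_int)
qed

text \<open>
  The Euclidean algorithm in the first column: a translation reduces the upper left entry modulo the
  lower left one, and the inversion exchanges them, so the norm of the lower left entry decreases.
  When it reaches 0, the determinant condition makes both diagonal entries units, and the matrix is a
  translation times a diagonal matrix.
\<close>

theorem SL2_0_hurwitz_realizable:
  assumes "S \<in> SL2_0_hurwitz"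
  shows "realizable S"
proof -
  have "S $ 2 $ 1 \<in> hurwitz" using assms by (simp add: SL2_0_hurwitz_def)
  then obtain n :: nat where "quat_norm (S $ 2 $ 1) = n" using quat_norm_hurwitz by blast
  then show ?thesis using assms
  proof (induction n arbitrary: S rule: less_induct)
    case (less n)
    show ?case
    proof (cases S)
      case (1 a b c d)
      note S = less.prems(2)[unfolded 1 mat2_in_SL2_0_hurwitz]
      show ?thesis
      proof (cases "c = 0")
        case True
        obtain k l :: nat where kl: "quat_norm a = k" "quat_norm d = l" using S quat_norm_hurwitz by metis
        \<comment> \<open>Norms of Hurwitz integers are natural numbers, so both factors are 1.\<close>
        have "quat_norm a * quat_norm d = 1" using S True by (simp add: quat_norm_mult algebra_simps)
        then have "k * l = 1" unfolding kl by (metis of_nat_eq_1_iff of_nat_mult)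
        then have "k = 1" "l = 1" by simp_all
        then have n: "quat_norm a = 1" "quat_norm d = 1" using kl by simp_all
        have "realizable (translation (b * quat_cnj d) ** diagonal a d)"
          using S n True by (intro realizable_mult realizable_translation realizable_diagonal) auto
        then show ?thesis using n True unfolding 1 by (simp add: mult.assoc quat_mult_cnj)
      next
        case False
        obtain h where h: "h \<in> hurwitz" "quat_norm (a - h * c) < quat_norm c"
          using hurwitz_division[OF False] by blast
        have "a - h * c \<in> hurwitz" using S h by auto
        then obtain k :: nat where k: "quat_norm (a - h * c) = k" using quat_norm_hurwitz by blast
        let ?T = "inversion ** (translation (- h) ** S)"
        have "quat_norm (?T $ 2 $ 1) = k" unfolding 1 using k quat_norm_simps(3)[of "a - h * c"] by simp
        moreover have "k < n" using h(2) less.prems(1) k unfolding 1 by simp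
        moreover have "?T \<in> SL2_0_hurwitz"
          using less.prems(2) h(1) by (intro inversion_mult translation_mult) auto
        ultimately have T: "realizable ?T" using less.IH by blast
        have "realizable (- inversion)" using realizable_inversion by (simp only: realizable_uminus)
        then have "realizable (translation h ** (- inversion ** ?T))"
          by (intro realizable_mult[OF realizable_translation[OF h(1)]] realizable_mult[OF _ T])
        moreover have "translation h ** (- inversion ** ?T) = S" unfolding 1 by simp
        ultimately show ?thesis by simp
      qed
    qed
  qed
qed

section \<open>The even Weyl group as classes of words\<close>

text \<open>
  The number of letters 4 is defined modulo 2 because every exponent of a bond at node 4 is even.
\<close>

lemma B4pp_equiv_parity:
  assumes "B4pp_equiv u v"
  shows "even (length u) = even (length v) \<and> even (count_list u 4) = even (count_list v 4)"
  using assms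
proof (induction rule: coxeter_equiv.induct)
  case (braid u v i j k)
  have len: "length (concat (replicate k [i, j])) = 2 * k" by (induction k) auto
  have cnt: "count_list (concat (replicate k [i, j])) 4 = k * count_list [i, j] 4" by (induction k) auto
  have "even k" if "i = 4 \<or> j = 4"
    using braid(3-6) that unfolding B4pp_nodes_eq
    by (auto simp: coxeter_exponent_def B4pp_cartan_def doubleton_eq_iff numeral_eq_enat)
  then show ?case by (auto simp: len cnt)
qed auto

lemma B4pp_equiv_iff:
  assumes u: "u \<in> lists B4pp_nodes" and v: "v \<in> lists B4pp_nodes"
  shows "B4pp_equiv u v \<longleftrightarrow> B4pp_action u = B4pp_action v"
proof
  assume "B4pp_equiv u v"
  then show "B4pp_action u = B4pp_action v" using B4pp.word_action_cong by blast
next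
  assume eq: "B4pp_action u = B4pp_action v"
  have r: "rev v \<in> lists B4pp_nodes" using v by auto
  have "B4pp_equiv (rev v @ u) []"
    using u r action_rev(2)[OF v] by (intro B4pp.faithful) (auto simp: eq)
  from coxeter_equiv_append_left[OF this v]
  have "B4pp_equiv (v @ rev v @ u) v" by simp
  moreover have "B4pp_equiv (v @ rev v @ u) u"
    using coxeter_equiv_append_right[OF coxeter_equiv_rev_append[OF r] u] by simp
  ultimately show "B4pp_equiv u v" by (meson coxeter_equiv.sym coxeter_equiv.trans)
qed

abbreviation word_class :: "int list \<Rightarrow> int list set" where
  "word_class w \<equiv> coxeter_rel B4pp_nodes (coxeter_exponent B4pp_cartan) `` {w}"

lemma word_class_eq_iff:
  assumes "u \<in> lists B4pp_nodes" "v \<in> lists B4pp_nodes"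
  shows "word_class u = word_class v \<longleftrightarrow> B4pp_action u = B4pp_action v"
  using eq_equiv_class_iff[OF equiv_coxeter_rel assms] B4pp_equiv_iff[OF assms]
  by (simp add: coxeter_rel_def)

lemma word_class_eqD:
  assumes "word_class u = word_class v" "u \<in> lists B4pp_nodes" "v \<in> lists B4pp_nodes"
  shows "even (length u) = even (length v)" "even (count_list u 4) = even (count_list v 4)"
  using B4pp_equiv_parity B4pp_equiv_iff[OF assms(2,3)] assms word_class_eq_iff by blast+

abbreviation B4pp_even_group :: "int list set monoid" where
  "B4pp_even_group \<equiv> even_weyl_group B4pp_nodes B4pp_cartan"

definition even_words :: "int list set" where
  "even_words = {w \<in> lists B4pp_nodes. even (length w)}"

lemma even_words_lists: "w \<in> even_words \<Longrightarrow> w \<in> lists B4pp_nodes"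
  by (simp add: even_words_def)

lemma even_words_append: "u \<in> even_words \<Longrightarrow> v \<in> even_words \<Longrightarrow> u @ v \<in> even_words"
  by (auto simp: even_words_def)

lemma even_words_rev: "u \<in> even_words \<Longrightarrow> rev u \<in> even_words"
  by (auto simp: even_words_def)

lemma D4pp_even_words_iff: "w \<in> D4pp_even_words \<longleftrightarrow> w \<in> even_words \<and> even (count_list w 4)"
  by (auto simp: D4pp_even_words_def even_words_def)

lemma carrier_B4pp_even_group: "carrier B4pp_even_group = word_class ` even_words"
  by (auto simp: even_weyl_group_def even_words_def)

lemma one_B4pp_even_group: "\<one>\<^bsub>B4pp_even_group\<^esub> = word_class []"
  by (simp add: even_weyl_group_def weyl_group_def coxeter_group_def)

lemma mult_B4pp_even_group:
  assumes "u \<in> even_words" "v \<in> even_words"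
  shows "word_class u \<otimes>\<^bsub>B4pp_even_group\<^esub> word_class v = word_class (u @ v)"
  using coxeter_mult_class[of u B4pp_nodes v] assms
  by (simp add: even_weyl_group_def weyl_group_def even_words_def)

lemma word_class_rev_append:
  assumes "w \<in> lists B4pp_nodes"
  shows "word_class (rev w @ w) = word_class []"
proof -
  have "rev w \<in> lists B4pp_nodes" using assms by auto
  then show ?thesis
    using assms action_rev[OF assms] by (subst word_class_eq_iff) auto
qed

lemma group_B4pp_even_group: "group B4pp_even_group"
proof (rule groupI)
  note simps = carrier_B4pp_even_group one_B4pp_even_group
  have nil: "[] \<in> even_words" by (simp add: even_words_def)
  show "\<one>\<^bsub>B4pp_even_group\<^esub> \<in> carrier B4pp_even_group" unfolding simps using nil by blast
  show "x \<otimes>\<^bsub>B4pp_even_group\<^esub> y \<in> carrier B4pp_even_group"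
    if "x \<in> carrier B4pp_even_group" "y \<in> carrier B4pp_even_group" for x y
    using that unfolding simps by (auto simp: mult_B4pp_even_group even_words_append)
  show "x \<otimes>\<^bsub>B4pp_even_group\<^esub> y \<otimes>\<^bsub>B4pp_even_group\<^esub> z = x \<otimes>\<^bsub>B4pp_even_group\<^esub> (y \<otimes>\<^bsub>B4pp_even_group\<^esub> z)"
    if "x \<in> carrier B4pp_even_group" "y \<in> carrier B4pp_even_group" "z \<in> carrier B4pp_even_group" for x y z
    using that unfolding simps by (auto simp: mult_B4pp_even_group even_words_append)
  show "\<one>\<^bsub>B4pp_even_group\<^esub> \<otimes>\<^bsub>B4pp_even_group\<^esub> x = x" if "x \<in> carrier B4pp_even_group" for x
    using that nil unfolding simps by (auto simp: mult_B4pp_even_group)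
  show "\<exists>y\<in>carrier B4pp_even_group. y \<otimes>\<^bsub>B4pp_even_group\<^esub> x = \<one>\<^bsub>B4pp_even_group\<^esub>"
    if x: "x \<in> carrier B4pp_even_group" for x
  proof -
    obtain w where w: "w \<in> even_words" "x = word_class w" using x unfolding simps by blast
    have "word_class (rev w) \<otimes>\<^bsub>B4pp_even_group\<^esub> x = \<one>\<^bsub>B4pp_even_group\<^esub>"
      unfolding w(2) simps mult_B4pp_even_group[OF even_words_rev[OF w(1)] w(1)]
      by (rule word_class_rev_append[OF even_words_lists[OF w(1)]])
    then show ?thesis using even_words_rev[OF w(1)] unfolding simps by blast
  qed
qed

lemma inv_B4pp_even_group:
  assumes w: "w \<in> even_words"
  shows "inv\<^bsub>B4pp_even_group\<^esub> (word_class w) = word_class (rev w)"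
proof (rule group.inv_equality[OF group_B4pp_even_group])
  show "word_class (rev w) \<otimes>\<^bsub>B4pp_even_group\<^esub> word_class w = \<one>\<^bsub>B4pp_even_group\<^esub>"
    unfolding mult_B4pp_even_group[OF even_words_rev[OF w] w] one_B4pp_even_group
    by (rule word_class_rev_append[OF even_words_lists[OF w]])
qed (use w even_words_rev in \<open>auto simp: carrier_B4pp_even_group\<close>)

section \<open>The semidirect decomposition\<close>

definition D4pp_even_subgroup :: "int list set set" where
  "D4pp_even_subgroup = word_class ` D4pp_even_words"

text \<open>
  The reflections 4 and \<open>-1\<close> commute, so their product is an involution; it is even, but has an odd
  number of letters 4.
\<close>

definition B4pp_complement :: "int list set set" where
  "B4pp_complement = {word_class [], word_class [4, -1]}"

lemma word_class_in_D4pp_even_subgroup: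
  assumes "w \<in> even_words"
  shows "word_class w \<in> D4pp_even_subgroup \<longleftrightarrow> even (count_list w 4)"
proof
  assume "word_class w \<in> D4pp_even_subgroup"
  then obtain v where v: "v \<in> D4pp_even_words" "word_class w = word_class v"
    unfolding D4pp_even_subgroup_def by (rule imageE)
  then have "even (count_list w 4) = even (count_list v 4)"
    using assms by (intro word_class_eqD(2)) (simp_all add: even_words_def D4pp_even_words_def)
  then show "even (count_list w 4)" using v(1) by (simp add: D4pp_even_words_def)
next
  assume "even (count_list w 4)"
  then have "w \<in> D4pp_even_words" using assms by (simp add: D4pp_even_words_iff)
  then show "word_class w \<in> D4pp_even_subgroup" unfolding D4pp_even_subgroup_def by (rule imageI)
qed

lemma D4pp_even_subgroup_normal: "D4pp_even_subgroup \<lhd> B4pp_even_group"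
proof -
  interpret group B4pp_even_group by (rule group_B4pp_even_group)
  have sub: "D4pp_even_subgroup \<subseteq> carrier B4pp_even_group"
    by (auto simp: D4pp_even_subgroup_def carrier_B4pp_even_group D4pp_even_words_iff)
  have "subgroup D4pp_even_subgroup B4pp_even_group"
  proof (rule subgroupI[OF sub])
    have "[] \<in> D4pp_even_words" by (simp add: D4pp_even_words_def)
    then show "D4pp_even_subgroup \<noteq> {}" by (auto simp: D4pp_even_subgroup_def)
    show "inv\<^bsub>B4pp_even_group\<^esub> a \<in> D4pp_even_subgroup" if "a \<in> D4pp_even_subgroup" for a
      using that by (auto simp: D4pp_even_subgroup_def inv_B4pp_even_group D4pp_even_words_iff even_words_rev)
    show "a \<otimes>\<^bsub>B4pp_even_group\<^esub> b \<in> D4pp_even_subgroup"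
      if "a \<in> D4pp_even_subgroup" "b \<in> D4pp_even_subgroup" for a b
      using that by (auto simp: D4pp_even_subgroup_def mult_B4pp_even_group D4pp_even_words_iff even_words_append)
  qed
  then show ?thesis
  proof (rule normal_invI)
    fix x h assume "x \<in> carrier B4pp_even_group" and h: "h \<in> D4pp_even_subgroup"
    then obtain u v where uv: "u \<in> even_words" "x = word_class u" "v \<in> D4pp_even_words" "h = word_class v"
      by (auto simp: carrier_B4pp_even_group D4pp_even_subgroup_def)
    then have v: "v \<in> even_words" "even (count_list v 4)" by (simp_all add: D4pp_even_words_iff)
    have w: "u @ v @ rev u \<in> even_words" by (intro even_words_append even_words_rev uv v)
    have "x \<otimes>\<^bsub>B4pp_even_group\<^esub> h \<otimes>\<^bsub>B4pp_even_group\<^esub> inv\<^bsub>B4pp_even_group\<^esub> x = word_class (u @ v @ rev u)"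
      using uv v by (simp add: inv_B4pp_even_group mult_B4pp_even_group even_words_append even_words_rev)
    then show "x \<otimes>\<^bsub>B4pp_even_group\<^esub> h \<otimes>\<^bsub>B4pp_even_group\<^esub> inv\<^bsub>B4pp_even_group\<^esub> x \<in> D4pp_even_subgroup"
      using word_class_in_D4pp_even_subgroup[OF w] v by simp
  qed
qed

lemma D4pp_even_subgroup_coset:
  assumes w: "w \<in> even_words"
  shows "D4pp_even_subgroup #>\<^bsub>B4pp_even_group\<^esub> word_class w =
    {word_class v | v. v \<in> even_words \<and> even (count_list v 4) = even (count_list w 4)}" (is "?l = ?r")
proof
  show "?l \<subseteq> ?r"
    using w by (force simp: r_coset_def D4pp_even_subgroup_def mult_B4pp_even_group D4pp_even_words_iff
        intro: even_words_append)
  show "?r \<subseteq> ?l"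
  proof
    fix x assume "x \<in> ?r"
    then obtain v where v: "v \<in> even_words" "even (count_list v 4) = even (count_list w 4)" "x = word_class v"
      by blast
    have vw: "v @ rev w \<in> even_words" using v w by (intro even_words_append even_words_rev)
    have "word_class (v @ rev w) \<in> D4pp_even_subgroup"
      using word_class_in_D4pp_even_subgroup[OF vw] v by simp
    moreover have "B4pp_action ((v @ rev w) @ w) = B4pp_action v"
      using action_rev(2)[OF even_words_lists[OF w]] by (intro ext) simp
    then have "word_class ((v @ rev w) @ w) = x"
      unfolding v(3) using v(1) w vw even_words_append even_words_lists
      by (intro word_class_eq_iff[THEN iffD2]) blast+
    then have "x = word_class (v @ rev w) \<otimes>\<^bsub>B4pp_even_group\<^esub> word_class w"
      by (simp only: mult_B4pp_even_group[OF vw w])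
    ultimately show "x \<in> ?l" unfolding r_coset_def by blast
  qed
qed

lemma four_minus_one_even_word: "[4, -1] \<in> even_words"
  by (simp add: even_words_def B4pp_nodes_def)

lemma card_rcosets_D4pp_even_subgroup: "card (rcosets\<^bsub>B4pp_even_group\<^esub> D4pp_even_subgroup) = 2"
proof -
  define C where "C b = {word_class v | v. v \<in> even_words \<and> even (count_list v 4) = b}" for b
  have nil: "[] \<in> even_words" by (simp add: even_words_def)
  have "rcosets\<^bsub>B4pp_even_group\<^esub> D4pp_even_subgroup = (\<lambda>w. C (even (count_list w 4))) ` even_words"
    unfolding RCOSETS_def carrier_B4pp_even_group by (auto simp: D4pp_even_subgroup_coset C_def)
  also have "\<dots> = C ` (\<lambda>w. even (count_list w 4)) ` even_words" by (simp only: image_image)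
  also have "(\<lambda>w. even (count_list w 4)) ` even_words = {True, False}"
    using imageI[OF nil, of "\<lambda>w. even (count_list w 4)"]
      imageI[OF four_minus_one_even_word, of "\<lambda>w. even (count_list w 4)"] by auto
  also have "C ` {True, False} = {C True, C False}" by simp
  finally have "rcosets\<^bsub>B4pp_even_group\<^esub> D4pp_even_subgroup = {C True, C False}" .
  moreover have "word_class [] \<in> C True" using nil by (force simp: C_def)
  moreover have "word_class [] \<notin> C False"
  proof
    assume "word_class [] \<in> C False"
    then obtain v where v: "v \<in> even_words" "odd (count_list v 4)" "word_class [] = word_class v"
      unfolding C_def by blast
    from word_class_eqD(2)[OF v(3) _ even_words_lists[OF v(1)]] v(2) show False by simp
  qed
  ultimately show ?thesis by (metis card_2_iff)
qed

lemma B4pp_complement_card: "card B4pp_complement = 2"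
proof -
  have "word_class [] \<noteq> word_class [4, -1]"
    using word_class_eqD(2)[of "[]" "[4, -1]"] by (auto simp: B4pp_nodes_def)
  then show ?thesis unfolding B4pp_complement_def by (rule card_2_iff[THEN iffD2, OF exI, OF exI, OF conjI[OF HOL.refl]])
qed

lemma B4pp_complement_subgroup: "subgroup B4pp_complement B4pp_even_group"
proof -
  interpret group B4pp_even_group by (rule group_B4pp_even_group)
  have nil: "[] \<in> even_words" by (simp add: even_words_def)
  have inv: "word_class [-1, 4] = word_class [4, -1]" and sq: "word_class [4, -1, 4, -1] = word_class []"
  proof -
    have "B4pp_action [-1, 4] x = B4pp_action [4, -1] x" "B4pp_action [4, -1, 4, -1] x = B4pp_action [] x" for x
      by (cases x rule: hermitian_exhaust; simp add: B4pp_reflection_simps)+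
    then show "word_class [-1, 4] = word_class [4, -1]" "word_class [4, -1, 4, -1] = word_class []"
      by (intro word_class_eq_iff[THEN iffD2] ext; simp add: B4pp_nodes_def)+
  qed
  show ?thesis
  proof (rule subgroupI)
    show "B4pp_complement \<subseteq> carrier B4pp_even_group"
      using nil four_minus_one_even_word by (auto simp: B4pp_complement_def carrier_B4pp_even_group)
    show "inv\<^bsub>B4pp_even_group\<^esub> a \<in> B4pp_complement" if "a \<in> B4pp_complement" for a
      using that inv_B4pp_even_group[OF nil] inv_B4pp_even_group[OF four_minus_one_even_word] inv
      by (auto simp: B4pp_complement_def)
    show "a \<otimes>\<^bsub>B4pp_even_group\<^esub> b \<in> B4pp_complement" if "a \<in> B4pp_complement" "b \<in> B4pp_complement" for a b
      using that unfolding B4pp_complement_def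
      by (elim insertE emptyE; hypsubst)
        (simp_all only: mult_B4pp_even_group[OF nil nil] mult_B4pp_even_group[OF nil four_minus_one_even_word]
          mult_B4pp_even_group[OF four_minus_one_even_word nil] append.simps sq insert_iff
          mult_B4pp_even_group[OF four_minus_one_even_word four_minus_one_even_word] simp_thms)
  qed (simp add: B4pp_complement_def)
qed

lemma D4pp_even_subgroup_Int_complement:
  "D4pp_even_subgroup \<inter> B4pp_complement = {\<one>\<^bsub>B4pp_even_group\<^esub>}"
proof -
  have "word_class [] \<in> D4pp_even_subgroup"
    by (subst word_class_in_D4pp_even_subgroup) (simp_all add: even_words_def)
  moreover have "word_class [4, -1] \<notin> D4pp_even_subgroup"
    by (subst word_class_in_D4pp_even_subgroup[OF four_minus_one_even_word]) simp
  ultimately show ?thesis unfolding B4pp_complement_def one_B4pp_even_group by blast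
qed

lemma D4pp_even_subgroup_mult_complement:
  "D4pp_even_subgroup <#>\<^bsub>B4pp_even_group\<^esub> B4pp_complement = carrier B4pp_even_group"
proof
  interpret group B4pp_even_group by (rule group_B4pp_even_group)
  show "D4pp_even_subgroup <#>\<^bsub>B4pp_even_group\<^esub> B4pp_complement \<subseteq> carrier B4pp_even_group"
    using normal_imp_subgroup[OF D4pp_even_subgroup_normal] B4pp_complement_subgroup
    by (intro set_mult_closed) (auto dest: subgroup.subset)
  show "carrier B4pp_even_group \<subseteq> D4pp_even_subgroup <#>\<^bsub>B4pp_even_group\<^esub> B4pp_complement"
  proof
    fix x assume "x \<in> carrier B4pp_even_group"
    then obtain w where w: "w \<in> even_words" "x = word_class w" by (auto simp: carrier_B4pp_even_group)
    let ?k = "if even (count_list w 4) then [] else [4, -1 :: int]"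
    have k: "?k \<in> even_words" using four_minus_one_even_word by (simp add: even_words_def)
    have "even (count_list ?k 4) = even (count_list w 4)" by simp
    then have "x \<in> D4pp_even_subgroup #>\<^bsub>B4pp_even_group\<^esub> word_class ?k"
      unfolding D4pp_even_subgroup_coset[OF k] using w by blast
    moreover have "word_class ?k \<in> B4pp_complement" by (simp add: B4pp_complement_def)
    ultimately show "x \<in> D4pp_even_subgroup <#>\<^bsub>B4pp_even_group\<^esub> B4pp_complement"
      unfolding r_coset_def set_mult_def by blast
  qed
qed

section \<open>The isomorphism\<close>

lemma SL2_0_hurwitz_uminus: "S \<in> SL2_0_hurwitz \<Longrightarrow> - S \<in> SL2_0_hurwitz"
  by (cases S) (auto simp: mat2_in_SL2_0_hurwitz)

lemma coset_plus_minus_1: "{mat 1, - mat 1} #>\<^bsub>SL2_quat\<^esub> S = {S, - S}"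
  by (auto simp: r_coset_def SL2_quat_def matrix_minus_mult)

lemma carrier_PSL2_0_hurwitz: "carrier PSL2_0_hurwitz = {{S, - S} | S. S \<in> SL2_0_hurwitz}"
proof -
  have P: "carrier PSL2_quat = {{S, - S} | S. S \<in> carrier SL2_quat}"
    by (auto simp: PSL2_quat_def FactGroup_def RCOSETS_def coset_plus_minus_1)
  have "X \<in> carrier PSL2_0_hurwitz \<longleftrightarrow> (\<exists>S. X = {S, - S} \<and> S \<in> SL2_0_hurwitz)" for X
    unfolding PSL2_0_hurwitz_def PSL2_hurwitz_def P SL2_0_hurwitz_def
    by (auto intro: hurwitz_uminus) (metis hurwitz_uminus minus_minus)+
  then show ?thesis by blast
qed

lemma mult_PSL2_0_hurwitz:
  "{S, - S} \<otimes>\<^bsub>PSL2_0_hurwitz\<^esub> {T, - T} = {S ** T, - (S ** T)}"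
  by (auto simp: PSL2_0_hurwitz_def PSL2_quat_def FactGroup_def set_mult_def SL2_quat_def matrix_minus_mult)

text \<open>
  Taking the set of all realizing matrices, which is some \<open>{S, -S}\<close>, makes the map to \<open>PSL\<^sub>2\<close>
  independent of choices of words and of signs.
\<close>

definition realizing_matrices :: "int list set \<Rightarrow> (quat^2^2) set" where
  "realizing_matrices X = {S \<in> SL2_0_hurwitz. \<exists>w\<in>X. realizes S w}"

lemma realizing_matrices_word_class:
  assumes w: "w \<in> D4pp_even_words" and S: "S \<in> SL2_0_hurwitz" "realizes S w"
  shows "realizing_matrices (word_class w) = {S, - S}"
proof -
  have "w \<in> lists B4pp_nodes" using w by (simp add: D4pp_even_words_def)
  then have self: "w \<in> word_class w" by (auto simp: coxeter_rel_def intro: coxeter_equiv.refl)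
  have "realizes T w" if "v \<in> word_class w" "realizes T v" for T v
    using that B4pp.word_action_cong[of w v] by (simp add: coxeter_rel_def realizes_def)
  then have "realizing_matrices (word_class w) = {T \<in> SL2_0_hurwitz. realizes T w}"
    using self by (auto simp: realizing_matrices_def)
  also have "\<dots> = {S, - S}"
    using S SL2_0_hurwitz_uminus realizes_unique[OF w S(2)] by auto
  finally show ?thesis .
qed

text \<open>
  A product of matrices that realize \<open>u\<close> and \<open>v\<close> realizes \<open>u v\<close>, so by uniqueness it agrees up to sign with
  a matrix in the group that does so. Injectivity is the faithfulness of the reflection representation,
  surjectivity the generation of the matrix group.
\<close>

lemma realizing_matrices_iso:
  "realizing_matrices \<in> iso (B4pp_even_group\<lparr>carrier := D4pp_even_subgroup\<rparr>) PSL2_0_hurwitz"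
proof (rule isoI)
  show "realizing_matrices \<in> hom (B4pp_even_group\<lparr>carrier := D4pp_even_subgroup\<rparr>) PSL2_0_hurwitz"
  proof (rule homI; simp)
    fix x assume "x \<in> D4pp_even_subgroup"
    then obtain u where u: "u \<in> D4pp_even_words" "x = word_class u" by (auto simp: D4pp_even_subgroup_def)
    obtain S where S: "S \<in> SL2_0_hurwitz" "realizes S u" using even_word_realized[OF u(1)] by blast
    show "realizing_matrices x \<in> carrier PSL2_0_hurwitz"
      using realizing_matrices_word_class[OF u(1) S] S(1) u(2) by (auto simp: carrier_PSL2_0_hurwitz)
    fix y assume "y \<in> D4pp_even_subgroup"
    then obtain v where v: "v \<in> D4pp_even_words" "y = word_class v" by (auto simp: D4pp_even_subgroup_def)
    obtain T where T: "T \<in> SL2_0_hurwitz" "realizes T v" using even_word_realized[OF v(1)] by blast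
    have uv: "u @ v \<in> D4pp_even_words" using u(1) v(1) by (rule D4pp_even_words_append)
    obtain R where R: "R \<in> SL2_0_hurwitz" "realizes R (u @ v)" using even_word_realized[OF uv] by blast
    have "S ** T = R \<or> S ** T = - R"
      using realizes_unique[OF uv R(2) realizes_mult[OF S(2) T(2)]] .
    then have "{R, - R} = {S ** T, - (S ** T)}" by auto
    then show "realizing_matrices (x \<otimes>\<^bsub>B4pp_even_group\<^esub> y) =
      realizing_matrices x \<otimes>\<^bsub>PSL2_0_hurwitz\<^esub> realizing_matrices y"
      using u v by (simp add: mult_B4pp_even_group D4pp_even_words_iff realizing_matrices_word_class[OF uv R]
          realizing_matrices_word_class[OF u(1) S] realizing_matrices_word_class[OF v(1) T] mult_PSL2_0_hurwitz)
  qed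
  have "inj_on realizing_matrices D4pp_even_subgroup"
  proof (rule inj_onI)
    fix x y assume "x \<in> D4pp_even_subgroup" "y \<in> D4pp_even_subgroup"
      and eq: "realizing_matrices x = realizing_matrices y"
    then obtain u v where uv: "u \<in> D4pp_even_words" "x = word_class u" "v \<in> D4pp_even_words" "y = word_class v"
      by (auto simp: D4pp_even_subgroup_def)
    obtain S where S: "S \<in> SL2_0_hurwitz" "realizes S u" using even_word_realized[OF uv(1)] by blast
    obtain T where T: "T \<in> SL2_0_hurwitz" "realizes T v" using even_word_realized[OF uv(3)] by blast
    have "{S, - S} = {T, - T}"
      using eq realizing_matrices_word_class[OF uv(1) S] realizing_matrices_word_class[OF uv(3) T] uv by simp
    then have "realizes S v" using T(2) by (metis insert_iff singletonD realizes_uminus)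
    then have "B4pp_action u = B4pp_action v"
      using S(2) by (auto simp: realizes_def hermitian_matrix_inject)
    then show "x = y" using uv word_class_eq_iff by (simp add: D4pp_even_words_def)
  qed
  moreover have "realizing_matrices ` D4pp_even_subgroup = carrier PSL2_0_hurwitz"
  proof
    show "realizing_matrices ` D4pp_even_subgroup \<subseteq> carrier PSL2_0_hurwitz"
    proof
      fix X assume "X \<in> realizing_matrices ` D4pp_even_subgroup"
      then obtain w where w: "w \<in> D4pp_even_words" "X = realizing_matrices (word_class w)"
        by (auto simp: D4pp_even_subgroup_def)
      obtain S where S: "S \<in> SL2_0_hurwitz" "realizes S w" using even_word_realized[OF w(1)] by blast
      then show "X \<in> carrier PSL2_0_hurwitz"
        using realizing_matrices_word_class[OF w(1) S] w(2) by (auto simp: carrier_PSL2_0_hurwitz)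
    qed
    show "carrier PSL2_0_hurwitz \<subseteq> realizing_matrices ` D4pp_even_subgroup"
    proof
      fix X assume "X \<in> carrier PSL2_0_hurwitz"
      then obtain S where S: "X = {S, - S}" "S \<in> SL2_0_hurwitz" by (auto simp: carrier_PSL2_0_hurwitz)
      obtain w where w: "w \<in> D4pp_even_words" "realizes S w"
        using SL2_0_hurwitz_realizable[OF S(2)] by (auto simp: realizable_def)
      have "X = realizing_matrices (word_class w)"
        using realizing_matrices_word_class[OF w(1) S(2) w(2)] S(1) by simp
      then show "X \<in> realizing_matrices ` D4pp_even_subgroup" using w(1) by (auto simp: D4pp_even_subgroup_def)
    qed
  qed
  ultimately show "bij_betw realizing_matrices (carrier (B4pp_even_group\<lparr>carrier := D4pp_even_subgroup\<rparr>)) (carrier PSL2_0_hurwitz)"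
    by (simp add: bij_betw_def)
qed

theorem proposition10:
  shows "semidirect_by_2 (even_weyl_group B4pp_nodes B4pp_cartan) PSL2_0_hurwitz"
  unfolding semidirect_by_2_def
  using D4pp_even_subgroup_normal realizing_matrices_iso card_rcosets_D4pp_even_subgroup
    B4pp_complement_subgroup B4pp_complement_card D4pp_even_subgroup_Int_complement
    D4pp_even_subgroup_mult_complement
  by (blast intro: is_isoI)

end
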